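(* Let $s, t, n$ be positive integers and define $m := \max\{t-1, 1\}$ if $s \in \{1,2\}$; $m := \sqrt{(s-2)n}$ if $s \geq 3$ and $t = 1$; and $m := 2\sqrt{(s-1)(t-1)n}$ otherwise. Then every $\mathcal{J}_{s,t}$-minor-free graph $G$ on $n$ vertices is isomorphic to a subgraph of $H \boxtimes K_{\lfloor m \rfloor}$ for some graph $H$ of treewidth at most $s$.
   Context: All graphs are finite, simple and undirected. $\mathcal{J}_{s,t}$ is the class of graphs whose vertex-set has a partition $A \cup B$ with $|A| = s$, $|B| = t$, $A$ a clique, every vertex of $A$ adjacent to every vertex of $B$, and $G[B]$ connected; $\mathcal{J}_{s,t}$-minor-free means containing no graph of $\mathcal{J}_{s,t}$ as a minor. The strong product $A \boxtimes B$ has vertex-set $V(A)\times V(B)$, where distinct $(v,x),(w,y)$ are adjacent if ($v=w$ and $xy\in E(B)$), or ($x=y$ and $vw\in E(A)$), or ($vw\in E(A)$ and $xy\in E(B)$). $K_m$ is the complete graph on $m$ vertices. *)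

theory Defs
  imports Complex_Main "Graph_Theory.Graph_Theory"
begin

text \<open>Finite simple undirected graphs are rendered by the locale predicate \<^const>\<open>pair_graph\<close>:
  finite, loop-free, symmetric, without parallel arcs. An edge \<open>uv\<close> is the pair of
  arcs \<open>(u,v)\<close> and \<open>(v,u)\<close>. The constant \<^const>\<open>Digraph_Component.connected\<close> excludes the null graph.\<close>

definition subgraph_up_to_iso :: "'a pair_pre_digraph \<Rightarrow> 'b pair_pre_digraph \<Rightarrow> bool" where
  "subgraph_up_to_iso G K \<longleftrightarrow>
    (\<exists>S :: 'b pair_pre_digraph. pair_graph S \<and> subgraph (with_proj S) (with_proj K) \<and>
       digraph_iso (with_proj G) (with_proj S))"

definition complete_graph :: "nat \<Rightarrow> nat pair_pre_digraph" where
  "complete_graph m = \<lparr>pverts = {..<m}, parcs = {(i, j). i < m \<and> j < m \<and> i \<noteq> j}\<rparr>"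

lemma complete_digraph_complete_graph: "complete_digraph m (with_proj (complete_graph m))"
  by (auto simp: complete_digraph_pair_def complete_graph_def)

definition strong_product ::
    "'a pair_pre_digraph \<Rightarrow> 'b pair_pre_digraph \<Rightarrow> ('a \<times> 'b) pair_pre_digraph"
    (infixl \<open>\<boxtimes>\<close> 70) where
  "A \<boxtimes> B = \<lparr>pverts = pverts A \<times> pverts B,
     parcs = {((v, x), (w, y)) | v x w y.
       (v, x) \<in> pverts A \<times> pverts B \<and> (w, y) \<in> pverts A \<times> pverts B \<and> (v, x) \<noteq> (w, y) \<and>
       (v = w \<and> (x, y) \<in> parcs B \<or>
        x = y \<and> (v, w) \<in> parcs A \<or>
        (v, w) \<in> parcs A \<and> (x, y) \<in> parcs B)}\<rparr>"

text \<open>Contracting the edge \<open>uv\<close> keeps \<open>u\<close> as the name of the merged vertex; the loop and the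
  parallel edges that arise are suppressed.\<close>

definition contract_edge :: "'a pair_pre_digraph \<Rightarrow> 'a \<Rightarrow> 'a \<Rightarrow> 'a pair_pre_digraph" where
  "contract_edge G u v = (let f = (\<lambda>w. if w = v then u else w) in
     \<lparr>pverts = f ` pverts G,
      parcs = {(f x, f y) | x y. (x, y) \<in> parcs G \<and> f x \<noteq> f y}\<rparr>)"

inductive contracts_to :: "'a pair_pre_digraph \<Rightarrow> 'a pair_pre_digraph \<Rightarrow> bool" where
  refl: "contracts_to G G"
| step: "contracts_to G H \<Longrightarrow> (u, v) \<in> parcs H \<Longrightarrow> contracts_to G (contract_edge H u v)"

definition minor :: "'b pair_pre_digraph \<Rightarrow> 'a pair_pre_digraph \<Rightarrow> bool" where
  "minor X G \<longleftrightarrow>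
    (\<exists>S Y :: 'a pair_pre_digraph. pair_graph S \<and> subgraph (with_proj S) (with_proj G) \<and>
       contracts_to S Y \<and> digraph_iso (with_proj X) (with_proj Y))"

definition J_class :: "nat \<Rightarrow> nat \<Rightarrow> 'a pair_pre_digraph set" where
  "J_class s t = {X. pair_graph X \<and>
     (\<exists>A B. pverts X = A \<union> B \<and> A \<inter> B = {} \<and> card A = s \<and> card B = t \<and>
        (\<forall>x\<in>A. \<forall>y\<in>A. x \<noteq> y \<longrightarrow> (x, y) \<in> parcs X) \<and>
        (\<forall>x\<in>A. \<forall>y\<in>B. (x, y) \<in> parcs X) \<and>
        Digraph_Component.connected (with_proj X \<restriction> B))}"

text \<open>Every finite graph has an isomorphic copy with vertices in \<^typ>\<open>nat\<close>, so it suffices to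
  let the excluded minors (and, below, the trees of tree-decompositions) range over such graphs.\<close>

definition J_minor_free :: "nat \<Rightarrow> nat \<Rightarrow> 'a pair_pre_digraph \<Rightarrow> bool" where
  "J_minor_free s t G \<longleftrightarrow> \<not> (\<exists>X \<in> (J_class s t :: nat pair_pre_digraph set). minor X G)"

text \<open>The library's \<^const>\<open>Digraph_Component.tree\<close> is not usable here: in a symmetric digraph every
  edge yields a directed cycle of length 2. Undirected cycles have length at least 3.\<close>

definition undirected_tree :: "'a pair_pre_digraph \<Rightarrow> bool" where
  "undirected_tree T \<longleftrightarrow> pair_graph T \<and> Digraph_Component.connected (with_proj T) \<and>
     \<not> (\<exists>p. pre_digraph.cycle (with_proj T) p \<and> length p \<ge> 3)"

definition tree_decomposition ::
    "'a pair_pre_digraph \<Rightarrow> 'b pair_pre_digraph \<Rightarrow> ('b \<Rightarrow> 'a set) \<Rightarrow> bool" where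
  "tree_decomposition G T \<beta> \<longleftrightarrow> undirected_tree T \<and>
     (\<forall>x \<in> pverts T. \<beta> x \<subseteq> pverts G) \<and>
     (\<forall>(u, v) \<in> parcs G. \<exists>x \<in> pverts T. u \<in> \<beta> x \<and> v \<in> \<beta> x) \<and>
     (\<forall>v \<in> pverts G. Digraph_Component.connected (with_proj T \<restriction> {x \<in> pverts T. v \<in> \<beta> x}))"

definition td_width :: "'b pair_pre_digraph \<Rightarrow> ('b \<Rightarrow> 'a set) \<Rightarrow> int" where
  "td_width T \<beta> = int (Max ((\<lambda>x. card (\<beta> x)) ` pverts T)) - 1"

text \<open>For a finite graph the set below is nonempty (put all vertices into one bag) and bounded below
  by \<open>-1\<close>, so the infimum is a minimum. The null graph has treewidth \<open>-1\<close>.\<close>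

definition treewidth :: "'a pair_pre_digraph \<Rightarrow> int" where
  "treewidth G =
     Inf {td_width T \<beta> | (T :: nat pair_pre_digraph) \<beta>. tree_decomposition G T \<beta>}"

end

theory Submission
  imports Defs "HOL-Library.Disjoint_Sets"
begin

text \<open>Vertices are assigned to parts one part at a time. Every component \<open>C\<close> of the unassigned
  vertices is attached to at most \<open>s\<close> parts, these parts form a clique of the graph \<open>H\<close> built so far,
  and outside \<open>C\<close> there is a complete-graph model whose branch sets \<open>B i\<close> contain the vertices of
  these parts adjacent to \<open>C\<close>. If \<open>C\<close> is attached to fewer than \<open>s\<close> parts, then a small connected
  subset of \<open>C\<close> adjacent to all \<open>B i\<close> is a valid new part and a new branch set. A small set \<open>Z\<close> such
  that no component of \<open>C - Z\<close> is adjacent to all \<open>B i\<close> is also a valid new part: a component of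
  \<open>C - Z\<close> misses some \<open>B k\<close>, and if \<open>Z\<close> is minimal, then \<open>B k\<close> can absorb \<open>Z\<close>. If \<open>C\<close> is attached to
  \<open>s\<close> parts, then \<open>t\<close> disjoint connected subsets of \<open>C\<close> adjacent to all \<open>B i\<close> would give a forbidden
  minor. Small sets come from the Alon--Seymour--Thomas lemma for \<open>s \<ge> 3\<close> and from Menger's theorem
  for \<open>s \<le> 2\<close>. Since each new part is attached to a clique of \<open>H\<close>, the order of creation is a perfect
  elimination order of \<open>H\<close> and bounds its treewidth.\<close>

section \<open>Connected vertex sets\<close>

definition closed_in :: "'a rel \<Rightarrow> 'a set \<Rightarrow> 'a set \<Rightarrow> bool" where
  "closed_in E S R \<longleftrightarrow> R \<subseteq> S \<and> (\<forall>x\<in>R. \<forall>y\<in>S. (x, y) \<in> E \<longrightarrow> y \<in> R)"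

definition connected_in :: "'a rel \<Rightarrow> 'a set \<Rightarrow> bool" where
  "connected_in E S \<longleftrightarrow> S \<noteq> {} \<and> S \<times> S \<subseteq> rtrancl_on S E"

definition is_component :: "'a rel \<Rightarrow> 'a set \<Rightarrow> 'a set \<Rightarrow> bool" where
  "is_component E S C \<longleftrightarrow> closed_in E S C \<and> connected_in E C"

definition reach_within :: "'a rel \<Rightarrow> 'a set \<Rightarrow> 'a set \<Rightarrow> 'a set" where
  "reach_within E D A = rtrancl_on D E `` A"

lemma connected_in_nonempty: "connected_in E S \<Longrightarrow> S \<noteq> {}"
  by (simp add: connected_in_def)

lemma connected_inD: "connected_in E S \<Longrightarrow> x \<in> S \<Longrightarrow> y \<in> S \<Longrightarrow> (x, y) \<in> rtrancl_on S E"
  by (auto simp: connected_in_def)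

lemma connected_in_rootI:
  assumes "sym E" "r \<in> S" "\<And>x. x \<in> S \<Longrightarrow> (r, x) \<in> rtrancl_on S E"
  shows "connected_in E S"
proof -
  have "(x, y) \<in> rtrancl_on S E" if "x \<in> S" "y \<in> S" for x y
    using symD[OF rtrancl_on_sym[OF assms(1)] assms(3)[OF that(1)]] assms(3)[OF that(2)]
    by (rule rtrancl_on_trans)
  then show ?thesis using assms(2) by (auto simp: connected_in_def)
qed

lemma connected_in_mono: "connected_in E S \<Longrightarrow> E \<subseteq> F \<Longrightarrow> connected_in F S"
  unfolding connected_in_def by (auto intro: rtrancl_on_mono)

lemma connected_in_singleton [simp]: "connected_in E {x}"
  by (auto simp: connected_in_def)

lemma connected_in_Un:
  assumes "connected_in E P" "connected_in E Q" "P \<inter> Q \<noteq> {}"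
  shows "connected_in E (P \<union> Q)"
proof -
  obtain z where z_mem: "z \<in> P" "z \<in> Q" using assms(3) by blast
  have "(x, z) \<in> rtrancl_on (P \<union> Q) E" "(z, x) \<in> rtrancl_on (P \<union> Q) E" if "x \<in> P \<union> Q" for x
    using that z_mem connected_inD[OF assms(1)] connected_inD[OF assms(2)]
    by (auto intro: rtrancl_on_mono[OF order_refl])
  then have "(x, y) \<in> rtrancl_on (P \<union> Q) E" if "x \<in> P \<union> Q" "y \<in> P \<union> Q" for x y
    using that by (blast intro: rtrancl_on_trans)
  then show ?thesis using z_mem by (auto simp: connected_in_def)
qed

lemma connected_in_insert:
  assumes "sym E" "connected_in E P" "x \<in> P" "(x, y) \<in> E"
  shows "connected_in E (insert y P)"
proof -
  have "connected_in E {x, y}"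
    by (rule connected_in_rootI[OF assms(1), of x])
      (use assms(4) rtrancl_on_into_rtrancl_on[of x x "{x, y}" E y] in auto)
  then show ?thesis
    using connected_in_Un[OF assms(2), of "{x, y}"] assms(3) by (simp add: insert_absorb)
qed

lemma connected_in_Un_edge:
  assumes "sym E" "connected_in E P" "connected_in E Q" "x \<in> P" "y \<in> Q" "(x, y) \<in> E"
  shows "connected_in E (P \<union> Q)"
proof -
  have "connected_in E (insert y P)" using connected_in_insert[OF assms(1,2,4,6)] .
  then have "connected_in E (insert y P \<union> Q)"
    using assms(3) by (rule connected_in_Un) (use assms(5) in auto)
  then show ?thesis using assms(5) by (simp add: insert_absorb)
qed

lemma connected_in_image:
  assumes "connected_in E S"
    and "\<And>x y. x \<in> S \<Longrightarrow> y \<in> S \<Longrightarrow> (x, y) \<in> E \<Longrightarrow> h x = h y \<or> (h x, h y) \<in> F"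
  shows "connected_in F (h ` S)"
proof -
  have "(h x, h y) \<in> rtrancl_on (h ` S) F" if "(x, y) \<in> rtrancl_on S E" for x y
    using that
  proof (induction rule: rtrancl_on_induct)
    case (step y z)
    then show ?case using assms(2)[of y z] rtrancl_on_into_rtrancl_on by force
  qed simp
  then show ?thesis using assms(1) by (auto simp: connected_in_def)
qed

lemma rtrancl_on_closed_in:
  assumes "closed_in E S R" "x \<in> R" "(x, y) \<in> rtrancl_on S E"
  shows "(x, y) \<in> rtrancl_on R E"
  using assms(3)
proof (induction rule: rtrancl_on_induct)
  case (step y z)
  then have "z \<in> R" using assms(1) in_rtrancl_on_in_F(2)[OF step.IH] by (auto simp: closed_in_def)
  then show ?case using step rtrancl_on_into_rtrancl_on by metis
qed (use assms(2) in simp)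

lemma closed_in_absorb:
  assumes "closed_in E S R" "connected_in E Q" "Q \<subseteq> S" "Q \<inter> R \<noteq> {}"
  shows "Q \<subseteq> R"
proof
  fix y assume y_mem: "y \<in> Q"
  obtain x where x_mem: "x \<in> Q" "x \<in> R" using assms(4) by blast
  have "(x, y) \<in> rtrancl_on S E"
    using rtrancl_on_mono[OF order_refl assms(3) connected_inD[OF assms(2) x_mem(1) y_mem]] .
  then show "y \<in> R" using rtrancl_on_closed_in[OF assms(1) x_mem(2)] in_rtrancl_on_in_F(2) by metis
qed

lemma connected_in_crossing:
  assumes "connected_in E S" "x \<in> S" "x \<in> R" "y \<in> S" "y \<notin> R"
  obtains u v where "u \<in> S" "u \<in> R" "v \<in> S" "v \<notin> R" "(u, v) \<in> E"
proof (rule ccontr)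
  assume "\<not> thesis"
  then have "closed_in E S (S \<inter> R)" using that by (auto simp: closed_in_def)
  then have "S \<subseteq> S \<inter> R" by (rule closed_in_absorb[OF _ assms(1)]) (use assms(2,3) in auto)
  then show False using assms(4,5) by auto
qed

lemma reach_within_subset: "reach_within E D A \<subseteq> D"
  by (auto simp: reach_within_def dest: in_rtrancl_on_in_F)

lemma reach_within_base: "A \<inter> D \<subseteq> reach_within E D A"
  by (auto simp: reach_within_def)

lemma closed_in_reach_within: "closed_in E D (reach_within E D A)"
  by (auto simp: closed_in_def reach_within_def dest: in_rtrancl_on_in_F
      intro: rtrancl_on_into_rtrancl_on)

lemma reach_within_mono:
  "D \<subseteq> D' \<Longrightarrow> A \<subseteq> A' \<Longrightarrow> reach_within E D A \<subseteq> reach_within E D' A'"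
  by (auto simp: reach_within_def intro: rtrancl_on_mono)

lemma reach_within_least:
  assumes "closed_in E D R" "A \<inter> D \<subseteq> R"
  shows "reach_within E D A \<subseteq> R"
  using assms rtrancl_on_closed_in[OF assms(1)]
  by (auto simp: reach_within_def dest: in_rtrancl_on_in_F)

lemma reach_within_absorb:
  assumes "connected_in E Q" "Q \<subseteq> D" "Q \<inter> A \<noteq> {}"
  shows "Q \<subseteq> reach_within E D A"
  by (rule closed_in_absorb[OF closed_in_reach_within assms(1,2)])
    (use assms(2,3) reach_within_base[of A D E] in blast)

lemma connected_in_reach_within:
  assumes "sym E" "connected_in E B" "B \<subseteq> D"
  shows "connected_in E (reach_within E D B)"
proof -
  have B_subset: "B \<subseteq> reach_within E D B" using reach_within_base[of B D E] assms(3) by blast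
  obtain b where b_mem: "b \<in> B" using connected_in_nonempty[OF assms(2)] by blast
  show ?thesis
  proof (rule connected_in_rootI[OF assms(1)])
    show "b \<in> reach_within E D B" using b_mem B_subset by blast
    fix v assume "v \<in> reach_within E D B"
    then obtain a where a_reaches: "a \<in> B" "(a, v) \<in> rtrancl_on D E"
      by (auto simp: reach_within_def)
    have "(b, a) \<in> rtrancl_on D E"
      using rtrancl_on_mono[OF order_refl assms(3) connected_inD[OF assms(2) b_mem a_reaches(1)]] .
    then have "(b, v) \<in> rtrancl_on D E" using a_reaches(2) by (rule rtrancl_on_trans)
    then show "(b, v) \<in> rtrancl_on (reach_within E D B) E"
      by (rule rtrancl_on_closed_in[OF closed_in_reach_within subsetD[OF B_subset b_mem]])
  qed
qed

lemma reach_withinE: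
  assumes "sym E" "v \<in> reach_within E D A"
  obtains X where "X \<subseteq> D" "connected_in E X" "X \<inter> A \<noteq> {}" "v \<in> X"
proof -
  obtain a where a_reaches: "a \<in> A" "(a, v) \<in> rtrancl_on D E"
    using assms(2) by (auto simp: reach_within_def)
  then have "a \<in> D" by (auto dest: in_rtrancl_on_in_F)
  show ?thesis
  proof (rule that)
    show "connected_in E (reach_within E D {a})"
      using assms(1) \<open>a \<in> D\<close> by (intro connected_in_reach_within) auto
    show "reach_within E D {a} \<inter> A \<noteq> {}" using a_reaches(1) \<open>a \<in> D\<close> by (auto simp: reach_within_def)
    show "v \<in> reach_within E D {a}" using a_reaches(2) by (simp add: reach_within_def)
  qed (rule reach_within_subset)
qed

lemma is_component_subset: "is_component E S C \<Longrightarrow> C \<subseteq> S"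
  by (simp add: is_component_def closed_in_def)

lemma is_component_connected: "is_component E S C \<Longrightarrow> connected_in E C"
  by (simp add: is_component_def)

lemma is_component_step:
  "is_component E S C \<Longrightarrow> x \<in> C \<Longrightarrow> y \<in> S \<Longrightarrow> (x, y) \<in> E \<Longrightarrow> y \<in> C"
  by (auto simp: is_component_def closed_in_def)

lemma component_exists:
  assumes "sym E" "x \<in> S"
  obtains C where "is_component E S C" "x \<in> C"
proof (rule that)
  show "is_component E S (reach_within E S {x})"
    using assms unfolding is_component_def
    by (intro conjI closed_in_reach_within connected_in_reach_within) auto
  show "x \<in> reach_within E S {x}" using assms(2) by (simp add: reach_within_def)
qed

lemma is_component_Diff_cases:
  assumes "sym E" and C_component: "is_component E S C"
    and "X \<subseteq> C" and D_component: "is_component E (S - X) D"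
  obtains "is_component E (C - X) D" | "is_component E S D" "D \<inter> C = {}" "E `` D \<inter> X = {}"
proof (cases "D \<inter> C = {}")
  case True
  have D_subset: "D \<subseteq> S - X" using D_component by (rule is_component_subset)
  have no_contact: "E `` D \<inter> X = {}"
  proof (rule ccontr)
    assume "E `` D \<inter> X \<noteq> {}"
    then obtain x y where "x \<in> D" "y \<in> X" "(x, y) \<in> E" by blast
    then have "x \<in> C"
      using is_component_step[OF C_component _ _ symD[OF assms(1)]] assms(3) D_subset by blast
    then show False using True \<open>x \<in> D\<close> by blast
  qed
  then have "is_component E S D" using D_component by (auto simp: is_component_def closed_in_def)
  then show ?thesis using that(2) True no_contact by blast
next
  case False
  have "D \<subseteq> C"
    using closed_in_absorb[of E S C D] C_component D_component False
    by (auto simp: is_component_def closed_in_def)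
  then have "is_component E (C - X) D"
    using D_component is_component_subset[OF C_component]
    by (auto simp: is_component_def closed_in_def)
  then show ?thesis by (rule that(1))
qed

section \<open>Connectors, separators and packings\<close>

definition connector :: "'a rel \<Rightarrow> 'a set \<Rightarrow> 'a set set \<Rightarrow> 'a set \<Rightarrow> bool" where
  "connector E C \<A> X \<longleftrightarrow> X \<subseteq> C \<and> connected_in E X \<and> (\<forall>A\<in>\<A>. X \<inter> A \<noteq> {})"

definition separates :: "'a rel \<Rightarrow> 'a set \<Rightarrow> 'a set set \<Rightarrow> 'a set \<Rightarrow> bool" where
  "separates E C \<A> Z \<longleftrightarrow> Z \<subseteq> C \<and> (\<forall>X. \<not> connector E (C - Z) \<A> X)"

definition packing :: "'a rel \<Rightarrow> 'a set \<Rightarrow> 'a set set \<Rightarrow> nat \<Rightarrow> 'a set set \<Rightarrow> bool" where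
  "packing E C \<A> t F \<longleftrightarrow>
    finite F \<and> card F = t \<and> disjoint F \<and> (\<forall>X\<in>F. connector E C \<A> X)"

lemma connector_nonempty: "connector E C \<A> X \<Longrightarrow> X \<noteq> {}"
  by (auto simp: connector_def connected_in_def)

lemma connector_mono: "connector E C \<A> X \<Longrightarrow> C \<subseteq> D \<Longrightarrow> E \<subseteq> F \<Longrightarrow> connector F D \<A> X"
  using connected_in_mono by (auto simp: connector_def)

lemma separates_Un:
  assumes "U \<subseteq> C" "separates E (C - U) \<A> Z"
  shows "separates E C \<A> (U \<union> Z)"
  using assms by (auto simp: separates_def Diff_eq Int_assoc)

lemma minimal_separator_exists:
  assumes "separates E C \<A> Z" "finite C"
  obtains Y where "separates E C \<A> Y" "card Y \<le> card Z"
    "\<And>y. y \<in> Y \<Longrightarrow> \<not> separates E C \<A> (Y - {y})"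
proof -
  obtain Y where Y_least: "separates E C \<A> Y" "\<And>Y'. separates E C \<A> Y' \<Longrightarrow> card Y \<le> card Y'"
    using ex_has_least_nat[of "separates E C \<A>" Z card] assms(1) by blast
  have "finite Y" using Y_least(1) assms(2) finite_subset by (auto simp: separates_def)
  then have "\<not> separates E C \<A> (Y - {y})" if "y \<in> Y" for y
    using Y_least(2) card_Diff1_less[OF _ that] by (meson not_less)
  then show ?thesis using that Y_least assms(1) by blast
qed

lemma packing_mono: "packing E C \<A> t F \<Longrightarrow> E \<subseteq> E' \<Longrightarrow> packing E' C \<A> t F"
  using connector_mono unfolding packing_def by blast

lemma packing_image:
  assumes "finite I" "disjoint_family_on W I" "\<And>i. i \<in> I \<Longrightarrow> connector E C \<A> (W i)"
  shows "packing E C \<A> (card I) (W ` I)"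
proof -
  have "disjoint (W ` I) \<and> inj_on W I"
    using disjoint_family_on_iff_disjoint_image[of I W] assms(2,3) connector_nonempty by blast
  then show ?thesis using assms(1,3) by (auto simp: packing_def card_image)
qed

lemma packing_insert:
  assumes "packing E C \<A> t F" "connector E (C - \<Union>F) \<A> X"
  shows "packing E C \<A> (Suc t) (insert X F)"
proof -
  have "X \<subseteq> C - \<Union>F" "X \<noteq> {}" using assms(2) connector_nonempty by (auto simp: connector_def)
  then have "X \<notin> F" "disjoint (insert X F)"
    using assms(1) by (auto simp: packing_def pairwise_insert disjnt_def)
  then show ?thesis
    using assms connector_mono[OF assms(2) Diff_subset order_refl] by (simp add: packing_def)
qed

definition hit_or_separate :: "'a rel \<Rightarrow> 'a set \<Rightarrow> nat \<Rightarrow> nat \<Rightarrow> bool" where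
  "hit_or_separate E V k M \<longleftrightarrow>
    (\<forall>C \<A>. C \<subseteq> V \<and> finite \<A> \<and> card \<A> \<le> k \<and> connector E C \<A> C \<longrightarrow>
      (\<exists>X. connector E C \<A> X \<and> card X \<le> M) \<or> (\<exists>Z. separates E C \<A> Z \<and> card Z \<le> M))"

definition pack_or_separate :: "'a rel \<Rightarrow> 'a set \<Rightarrow> nat \<Rightarrow> nat \<Rightarrow> nat \<Rightarrow> bool" where
  "pack_or_separate E V k t M \<longleftrightarrow>
    (\<forall>C \<A>. C \<subseteq> V \<and> finite \<A> \<and> \<A> \<noteq> {} \<and> card \<A> \<le> k \<and> connector E C \<A> C \<longrightarrow>
      (\<exists>F. packing E C \<A> t F) \<or> (\<exists>Z. separates E C \<A> Z \<and> card Z \<le> M))"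

lemma hit_or_separate_mono: "hit_or_separate E V k M \<Longrightarrow> l \<le> k \<Longrightarrow> hit_or_separate E V l M"
  unfolding hit_or_separate_def by (meson order_trans)

lemma pack_or_separate_mono: "pack_or_separate E V k t M \<Longrightarrow> l \<le> k \<Longrightarrow> pack_or_separate E V l t M"
  unfolding pack_or_separate_def by (meson order_trans)

section \<open>The Alon--Seymour--Thomas lemma\<close>

text \<open>The nodes at distance at most \<open>j\<close> from the copy of \<open>A 0\<close> at level \<open>0\<close> in the graph made of
  \<open>d\<close> copies of \<open>C\<close>, where the copies of \<open>v\<close> at levels \<open>i\<close> and \<open>i + 1\<close> are joined if
  \<open>v \<in> A (i + 1)\<close>.\<close>

primrec level_ball :: "'a rel \<Rightarrow> 'a set \<Rightarrow> (nat \<Rightarrow> 'a set) \<Rightarrow> nat \<Rightarrow> nat \<Rightarrow> (nat \<times> 'a) set" where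
  "level_ball E C A d 0 = {0} \<times> (A 0 \<inter> C)"
| "level_ball E C A d (Suc j) = level_ball E C A d j \<union>
     {(i, v). i < d \<and> v \<in> C \<and> (\<exists>u. (i, u) \<in> level_ball E C A d j \<and> (u, v) \<in> E)} \<union>
     {(Suc i, v) | i v. Suc i < d \<and> (i, v) \<in> level_ball E C A d j \<and> v \<in> A (Suc i)}"

lemma mono_level_ball: "mono (level_ball E C A d)"
  by (rule monoI, rule lift_Suc_mono_le) auto

lemma level_ball_subset: "d \<ge> 1 \<Longrightarrow> level_ball E C A d j \<subseteq> {..<d} \<times> C"
  by (induction j) auto

lemma level_ball_connector:
  assumes "sym E" "(i, v) \<in> level_ball E C A d j"
  shows "\<exists>X. finite X \<and> v \<in> X \<and> card X \<le> Suc j \<and> connector E C (A ` {..i}) X"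
  using assms(2)
proof (induction j arbitrary: i v)
  case 0
  then show ?case by (auto simp: connector_def intro!: exI[of _ "{v}"])
next
  case (Suc j)
  from Suc.prems consider
      (stay) "(i, v) \<in> level_ball E C A d j"
    | (edge) u where "v \<in> C" "(i, u) \<in> level_ball E C A d j" "(u, v) \<in> E"
    | (up) l where "i = Suc l" "(l, v) \<in> level_ball E C A d j" "v \<in> A (Suc l)"
    by auto
  then show ?case
  proof cases
    case stay
    show ?thesis using Suc.IH[OF stay] by (meson le_SucI)
  next
    case edge
    from Suc.IH[OF edge(2)] obtain X where X_connector: "finite X" "u \<in> X" "card X \<le> Suc j"
      "connector E C (A ` {..i}) X" by blast
    have "connector E C (A ` {..i}) (insert v X)"
      using X_connector(2,4) edge(1,3) connected_in_insert[OF assms(1)]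
      by (auto simp: connector_def)
    then show ?thesis
      using X_connector(1,3) by (intro exI[of _ "insert v X"]) (simp add: card_insert_if)
  next
    case up
    from Suc.IH[OF up(2)] obtain X where X_connector: "finite X" "v \<in> X" "card X \<le> Suc j"
      "connector E C (A ` {..l}) X" by blast
    then have "connector E C (A ` {..i}) X"
      using up(1,3) by (auto simp: connector_def atMost_Suc)
    then show ?thesis using X_connector by (intro exI[of _ X]) simp
  qed
qed

lemma level_ball_fill:
  assumes Q_connector: "connector E C (A ` {..d}) Q"
    and stable: "\<And>i v. v \<in> Q \<Longrightarrow> (i, v) \<in> level_ball E C A d (Suc l) \<Longrightarrow> (i, v) \<in> level_ball E C A d l"
    and "i < d"
  shows "{i} \<times> Q \<subseteq> level_ball E C A d l"
proof -
  let ?R = "level_ball E C A d"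
  have fill_copy: "{i} \<times> Q \<subseteq> ?R l" if "i < d" "a \<in> Q" "(i, a) \<in> ?R l" for i a
  proof -
    have "closed_in E Q {v \<in> Q. (i, v) \<in> ?R l}"
      using stable Q_connector that(1) by (auto simp: closed_in_def connector_def)
    then have "Q \<subseteq> {v \<in> Q. (i, v) \<in> ?R l}"
      by (rule closed_in_absorb) (use Q_connector that in \<open>auto simp: connector_def\<close>)
    then show ?thesis by blast
  qed
  show ?thesis using assms(3)
  proof (induction i)
    case 0
    obtain a where a_mem: "a \<in> Q" "a \<in> A 0" using Q_connector by (auto simp: connector_def)
    then have "(0, a) \<in> ?R 0" using Q_connector by (auto simp: connector_def)
    then have "(0, a) \<in> ?R l" using monoD[OF mono_level_ball, of 0 l] by blast
    then show ?case using fill_copy[OF 0 a_mem(1)] by blast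
  next
    case (Suc i)
    obtain a where a_mem: "a \<in> Q" "a \<in> A (Suc i)"
      using Q_connector Suc.prems by (fastforce simp: connector_def)
    then have "(Suc i, a) \<in> ?R (Suc l)" using Suc by auto
    then show ?case using fill_copy[OF Suc.prems a_mem(1)] stable[OF a_mem(1)] by blast
  qed
qed

lemma connector_avoiding_layer:
  assumes "sym E" "d \<ge> 1"
    and Q_avoids: "connector E (C - snd ` disjointed (level_ball E C A d) j) (A ` {..d}) Q"
  shows "\<exists>X. connector E C (A ` {..d}) X \<and> card X \<le> j"
proof -
  let ?R = "level_ball E C A d"
  have Q_connector: "connector E C (A ` {..d}) Q"
    using connector_mono[OF Q_avoids Diff_subset order_refl] .
  have not_in_layer: "(i, v) \<notin> disjointed ?R j" if "v \<in> Q" for i v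
    using that Q_avoids by (force simp: connector_def)
  have meets: "Q \<inter> A i \<noteq> {}" if "i \<le> d" for i using Q_avoids that by (auto simp: connector_def)
  obtain b where "b \<in> Q" "b \<in> A 0" using meets[of 0] by auto
  then obtain l where j_Suc: "j = Suc l"
    using Q_connector not_in_layer[of b 0] by (cases j) (auto simp: connector_def)
  have stable: "(i, v) \<in> ?R l" if "v \<in> Q" "(i, v) \<in> ?R (Suc l)" for i v
    using not_in_layer[OF that(1)] that(2)
    unfolding j_Suc disjointed_mono[OF mono_level_ball] by blast
  obtain a where a_mem: "a \<in> Q" "a \<in> A d" using meets[of d] by auto
  have "{d - 1} \<times> Q \<subseteq> ?R l" by (rule level_ball_fill[OF Q_connector stable]) (use assms(2) in auto)
  then have "(d - 1, a) \<in> ?R l" using a_mem(1) by blast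
  from level_ball_connector[OF assms(1) this] obtain X
    where X_connector: "a \<in> X" "card X \<le> Suc l" "connector E C (A ` {..d - 1}) X" by blast
  have "{..d} = insert d {..d - 1}" using assms(2) by auto
  then have "connector E C (A ` {..d}) X"
    using X_connector(1,3) a_mem(2) by (auto simp: connector_def)
  then show ?thesis using X_connector(2) j_Suc by auto
qed

lemma ex_small_disjoint_set:
  assumes "finite U" "disjoint_family_on L {..q}" "\<And>j. L j \<subseteq> U"
  shows "\<exists>j\<le>q. card (L j) * Suc q \<le> card U"
proof (rule ccontr)
  assume "\<not> ?thesis"
  then have "(\<Sum>j\<le>q. card U) < (\<Sum>j\<le>q. card (L j) * Suc q)"
    by (intro sum_strict_mono) auto
  also have "\<dots> = card (\<Union>j\<le>q. L j) * Suc q"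
    using card_UN_disjoint'[OF assms(2) finite_subset[OF assms(3,1)]]
    by (simp only: finite_atMost sum_distrib_right)
  also have "\<dots> \<le> card U * Suc q"
    using assms(1,3) by (intro mult_right_mono card_mono) auto
  finally show False by simp
qed

lemma indexed_connector_or_separator:
  fixes A :: "nat \<Rightarrow> 'a set"
  assumes "sym E" "finite C" "d \<ge> 1"
  shows "(\<exists>X. connector E C (A ` {..d}) X \<and> card X \<le> q) \<or>
    (\<exists>Z. separates E C (A ` {..d}) Z \<and> card Z * Suc q \<le> d * card C)"
proof -
  let ?L = "disjointed (level_ball E C A d)"
  have layer_subset: "?L j \<subseteq> {..<d} \<times> C" for j
    using disjointed_subset level_ball_subset[OF assms(3)] by (rule order_trans)
  have "disjoint_family_on ?L {..q}"
    by (rule disjoint_family_on_mono[OF subset_UNIV disjoint_family_disjointed])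
  then obtain j where small_layer: "j \<le> q" "card (?L j) * Suc q \<le> d * card C"
    using ex_small_disjoint_set[of "{..<d} \<times> C" ?L q] layer_subset assms(2) by auto
  show ?thesis
  proof (cases "separates E C (A ` {..d}) (snd ` ?L j)")
    case True
    have "card (snd ` ?L j) \<le> card (?L j)"
      by (rule card_image_le[OF finite_subset[OF layer_subset]]) (use assms(2) in simp)
    then show ?thesis using True small_layer(2) by (meson le_trans mult_le_mono1)
  next
    case False
    moreover have "snd ` ?L j \<subseteq> C" using layer_subset[of j] by auto
    ultimately obtain Q where "connector E (C - snd ` ?L j) (A ` {..d}) Q"
      by (auto simp: separates_def)
    then show ?thesis
      using connector_avoiding_layer[OF assms(1,3)] small_layer(1) by (meson order_trans)
  qed
qed

lemma connector_or_separator: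
  assumes "sym E" "finite C" "finite \<A>" "card \<A> \<le> Suc d" "d \<ge> 1"
  shows "(\<exists>X. connector E C \<A> X \<and> card X \<le> q) \<or>
    (\<exists>Z. separates E C \<A> Z \<and> card Z * Suc q \<le> d * card C)"
proof -
  define \<B> where "\<B> = (if \<A> = {} then {UNIV} else \<A>)"
  have connector_iff: "connector E D \<B> X \<longleftrightarrow> connector E D \<A> X" for D X
    using connected_in_nonempty by (auto simp: \<B>_def connector_def)
  have "\<exists>g. g ` \<B> \<subseteq> {..d} \<and> inj_on g \<B>"
    by (rule card_le_inj) (use assms(3,4) in \<open>auto simp: \<B>_def\<close>)
  moreover have "\<B> \<noteq> {}" by (simp add: \<B>_def)
  ultimately obtain A where "A ` {..d} = \<B>"
    using inj_on_iff_surj[of \<B> "{..d}"] by blast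
  then show ?thesis
    using indexed_connector_or_separator[OF assms(1,2,5), of A q]
    by (simp add: separates_def connector_iff)
qed

lemma packing_insert_or_separator:
  assumes "sym E" "finite C" "finite \<A>" "card \<A> \<le> Suc d" "d \<ge> 1"
    and packing: "packing E C \<A> t F" "\<forall>X\<in>F. card X \<le> q"
  shows "(\<exists>X. packing E C \<A> (Suc t) (insert X F) \<and> card X \<le> q) \<or>
    (\<exists>Z z. separates E C \<A> Z \<and> card Z \<le> t * q + z \<and> z * Suc q \<le> d * card C)"
proof -
  let ?U = "\<Union>F"
  have U_subset: "?U \<subseteq> C" using packing(1) by (auto simp: packing_def connector_def)
  from connector_or_separator[OF assms(1) finite_Diff[OF assms(2)] assms(3-5), of ?U q]
  consider (connector) X where "connector E (C - ?U) \<A> X" "card X \<le> q"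
    | (separator) Z where "separates E (C - ?U) \<A> Z" "card Z * Suc q \<le> d * card (C - ?U)"
    by blast
  then show ?thesis
  proof cases
    case connector
    then show ?thesis using packing_insert[OF packing(1)] by blast
  next
    case separator
    have "card ?U \<le> (\<Sum>X\<in>F. card X)" by (rule card_Union_le_sum_card)
    also have "\<dots> \<le> t * q"
      using sum_bounded_above[of F card q] packing by (simp add: packing_def)
    finally have "card (?U \<union> Z) \<le> t * q + card Z" using card_Un_le[of ?U Z] by linarith
    moreover have "card Z * Suc q \<le> d * card C"
      using separator(2) card_mono[OF assms(2) Diff_subset, of ?U]
      by (meson mult_le_mono2 order_trans)
    ultimately show ?thesis using separates_Un[OF U_subset separator(1)] by auto
  qed
qed

lemma packing_or_separator:
  assumes "sym E" "finite C" "finite \<A>" "card \<A> \<le> Suc d" "d \<ge> 1"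
  shows "(\<exists>F. packing E C \<A> t F \<and> (\<forall>X\<in>F. card X \<le> q)) \<or>
    (\<exists>Z z. separates E C \<A> Z \<and> card Z \<le> (t - 1) * q + z \<and> z * Suc q \<le> d * card C)"
proof (induction t)
  case 0
  have "packing E C \<A> 0 {}" by (simp add: packing_def)
  then show ?case by blast
next
  case (Suc t)
  then consider (packing) F where "packing E C \<A> t F" "\<forall>X\<in>F. card X \<le> q"
    | (separator) Z z where "separates E C \<A> Z" "card Z \<le> (t - 1) * q + z" "z * Suc q \<le> d * card C"
    by blast
  then show ?case
  proof cases
    case packing
    then show ?thesis using packing_insert_or_separator[OF assms packing] by auto
  next
    case separator
    have "(t - 1) * q \<le> t * q" by (rule mult_le_mono1) simp
    then have "card Z \<le> t * q + z" using separator(2) by linarith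
    then show ?thesis using separator(1,3) by auto
  qed
qed

section \<open>Menger's theorem\<close>

lemma separates_iff_reach_within:
  assumes "sym E"
  shows "separates E C {A, B} Z \<longleftrightarrow> Z \<subseteq> C \<and> reach_within E (C - Z) A \<inter> B = {}"
proof -
  have "(\<exists>X. connector E D {A, B} X) \<longleftrightarrow> reach_within E D A \<inter> B \<noteq> {}" for D
  proof
    assume "\<exists>X. connector E D {A, B} X"
    then obtain X where X_connects: "X \<subseteq> D" "connected_in E X" "X \<inter> A \<noteq> {}" "X \<inter> B \<noteq> {}"
      by (auto simp: connector_def)
    then show "reach_within E D A \<inter> B \<noteq> {}" using reach_within_absorb[OF X_connects(2,1,3)] by blast
  next
    assume "reach_within E D A \<inter> B \<noteq> {}"
    then obtain v where v_reached: "v \<in> reach_within E D A" "v \<in> B" by blast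
    from reach_withinE[OF assms v_reached(1)] obtain X
      where "X \<subseteq> D" "connected_in E X" "X \<inter> A \<noteq> {}" "v \<in> X" .
    then show "\<exists>X. connector E D {A, B} X" using v_reached(2) by (auto simp: connector_def)
  qed
  then show ?thesis by (auto simp: separates_def)
qed

lemma reach_within_disjoint:
  assumes "sym E" "separates E C {A, B} S"
  shows "reach_within E (C - S) A \<inter> reach_within E (C - S) B = {}"
proof (rule ccontr)
  assume "\<not> ?thesis"
  then obtain v where v_reached: "v \<in> reach_within E (C - S) A" "v \<in> reach_within E (C - S) B"
    by blast
  from reach_withinE[OF assms(1) v_reached(2)] obtain X
    where X_connects: "X \<subseteq> C - S" "connected_in E X" "X \<inter> B \<noteq> {}" "v \<in> X" .
  have "X \<subseteq> reach_within E (C - S) A"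
    using closed_in_absorb[OF closed_in_reach_within X_connects(2,1)] v_reached(1) X_connects(4)
    by blast
  then show False using X_connects(3) assms by (auto simp: separates_iff_reach_within)
qed

text \<open>Without the edge \<open>xy\<close>, everything reachable from \<open>A\<close> outside \<open>T\<close> stays on the side of \<open>A\<close>
  with respect to \<open>S\<close> and misses \<open>x\<close>, so the edge does not help to leave that side.\<close>

lemma separates_deleted_edge:
  assumes "sym E" "sym E'" "E \<subseteq> E' \<union> {(x, y), (y, x)}"
    and S_separates: "separates E' C {A, B} S" and y_side: "y \<notin> reach_within E' (C - S) A"
    and T_separates: "separates E' C {A, insert x S} T"
  shows "separates E C {A, B} T"
proof -
  let ?R = "reach_within E' (C - T) A"
  have avoid: "?R \<inter> insert x S = {}" and T_subset: "T \<subseteq> C"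
    using T_separates assms(2) by (auto simp: separates_iff_reach_within)
  have side: "?R \<subseteq> reach_within E' (C - S) A"
  proof
    fix v assume v_reached: "v \<in> ?R"
    from reach_withinE[OF assms(2) v_reached] obtain X
      where X_connects: "X \<subseteq> C - T" "connected_in E' X" "X \<inter> A \<noteq> {}" "v \<in> X" .
    have "X \<subseteq> ?R" using reach_within_absorb[OF X_connects(2,1,3)] .
    then have "X \<subseteq> C - S" using avoid X_connects(1) by blast
    then show "v \<in> reach_within E' (C - S) A"
      using reach_within_absorb[OF X_connects(2) _ X_connects(3)] X_connects(4) by blast
  qed
  have "closed_in E (C - T) ?R"
    using closed_in_reach_within[of E' "C - T" A] assms(3) avoid side y_side
    by (auto simp: closed_in_def)
  then have "reach_within E (C - T) A \<subseteq> ?R" by (rule reach_within_least) (rule reach_within_base)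
  moreover have "reach_within E' (C - S) A \<inter> B = {}"
    using S_separates assms(2) by (simp add: separates_iff_reach_within)
  ultimately show ?thesis using side T_subset assms(1) by (auto simp: separates_iff_reach_within)
qed

lemma separates_refl:
  assumes "T \<subseteq> C" "T \<in> \<A>"
  shows "separates E C \<A> T"
proof -
  have "\<not> connector E (C - T) \<A> X" for X
  proof
    assume "connector E (C - T) \<A> X"
    then have "X \<subseteq> C - T" "X \<inter> T \<noteq> {}" using assms(2) by (auto simp: connector_def)
    then show False by blast
  qed
  then show ?thesis using assms(1) by (simp add: separates_def)
qed

lemma deleted_edge_joins_sides:
  assumes "sym E" "sym E'" "(a, b) \<in> E" "E' = E - {(a, b), (b, a)}"
    and S_separates: "separates E' C {A, B} S" and not_S: "\<not> separates E C {A, B} S"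
  obtains x y where "(x, y) \<in> E" "E \<subseteq> E' \<union> {(x, y), (y, x)}"
    "x \<in> reach_within E' (C - S) A" "y \<in> reach_within E' (C - S) B"
proof -
  let ?R = "\<lambda>A. reach_within E' (C - S) A"
  have leave: "\<exists>u v. u \<in> ?R P \<and> v \<notin> ?R P \<and> (u, v) \<in> {(a, b), (b, a)}"
    if "separates E' C {P, Q} S" "\<not> separates E C {P, Q} S" for P Q
  proof -
    have "\<not> closed_in E (C - S) (?R P)"
    proof
      assume "closed_in E (C - S) (?R P)"
      then have "reach_within E (C - S) P \<subseteq> ?R P"
        by (rule reach_within_least) (rule reach_within_base)
      then show False using that assms(1,2) by (auto simp: separates_iff_reach_within)
    qed
    then obtain u v where crossing: "u \<in> ?R P" "v \<in> C - S" "(u, v) \<in> E" "v \<notin> ?R P"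
      using reach_within_subset[of E' "C - S" P] unfolding closed_in_def by blast
    then have "(u, v) \<notin> E'"
      using closed_in_reach_within[of E' "C - S" P] unfolding closed_in_def by blast
    then show ?thesis using crossing unfolding assms(4) by blast
  qed
  obtain x y where A_crossing: "x \<in> ?R A" "y \<notin> ?R A" "(x, y) \<in> {(a, b), (b, a)}"
    using leave[OF S_separates not_S] by blast
  obtain u v where crossing: "u \<in> ?R B" "v \<notin> ?R B" "(u, v) \<in> {(a, b), (b, a)}"
    using leave[of B A] S_separates not_S by (auto simp: insert_commute)
  have "u \<noteq> x"
    using A_crossing(1) crossing(1) reach_within_disjoint[OF assms(2) S_separates] by blast
  then have "u = y" using A_crossing(3) crossing(3) by auto
  then show ?thesis
    using that[of x y] A_crossing crossing(1) assms(3,4) symD[OF assms(1,3)] by auto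
qed

lemma connected_trim:
  assumes "sym E" "connected_in E X" "p \<in> X" "X \<inter> A \<noteq> {}"
  obtains Y where "Y \<subseteq> X" "p \<in> Y" "connected_in E Y" "Y \<inter> A \<noteq> {}"
    "Y \<subseteq> insert p (reach_within E (X - {p}) A)"
proof (cases "p \<in> A")
  case True
  show ?thesis by (rule that[of "{p}"]) (use assms(3) True in auto)
next
  case False
  obtain a where a_mem: "a \<in> X" "a \<in> A" "a \<noteq> p" using assms(4) False by blast
  let ?D = "reach_within E (X - {p}) {a}"
  have D_reach: "?D \<subseteq> X - {p}" "a \<in> ?D"
    using reach_within_subset[of E "X - {p}"] reach_within_base[of "{a}" "X - {p}" E] a_mem by auto
  obtain u v where crossing: "u \<in> X" "u \<in> ?D" "v \<in> X" "v \<notin> ?D" "(u, v) \<in> E"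
    using connected_in_crossing[OF assms(2) a_mem(1) D_reach(2) assms(3)] D_reach(1) by blast
  have "v = p"
    using closed_in_reach_within[of E "X - {p}" "{a}"] crossing by (auto simp: closed_in_def)
  moreover have "connected_in E ?D" using assms(1) a_mem by (intro connected_in_reach_within) auto
  ultimately have "connected_in E (insert p ?D)"
    using connected_in_insert[OF assms(1) _ crossing(2)] crossing(5) by blast
  moreover have "?D \<subseteq> reach_within E (X - {p}) A"
    using a_mem(2) by (intro reach_within_mono) auto
  ultimately show ?thesis using D_reach a_mem(2) assms(3) by (intro that[of "insert p ?D"]) auto
qed

lemma packing_index_by_endpoints:
  assumes F_packing: "packing E C {A, P} (card P) F" and "finite P"
  obtains k where "disjoint_family_on k P" "\<forall>p\<in>P. connector E C {A, P} (k p) \<and> p \<in> k p"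
proof -
  have "\<forall>X\<in>F. \<exists>p. p \<in> X \<inter> P" using F_packing by (auto simp: packing_def connector_def)
  then obtain h where endpoint: "\<And>X. X \<in> F \<Longrightarrow> h X \<in> X \<inter> P" by metis
  have disjoint_members: "X \<inter> Y = {}" if "X \<in> F" "Y \<in> F" "X \<noteq> Y" for X Y
    using F_packing that by (auto simp: packing_def pairwise_def disjnt_def)
  have "inj_on h F" using endpoint disjoint_members by (fastforce intro!: inj_onI)
  then have "card (h ` F) = card P" using F_packing by (simp add: card_image packing_def)
  then have endpoint_image: "h ` F = P" using endpoint assms(2) by (intro card_subset_eq) auto
  let ?k = "inv_into F h"
  have inverse: "?k p \<in> F" "h (?k p) = p" if "p \<in> P" for p
    using that endpoint_image inv_into_into[of p h F] f_inv_into_f[of p h F] by auto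
  show ?thesis
  proof (rule that)
    show "disjoint_family_on ?k P"
      using disjoint_members inverse unfolding disjoint_family_on_def by metis
    show "\<forall>p\<in>P. connector E C {A, P} (?k p) \<and> p \<in> ?k p"
    proof
      fix p assume "p \<in> P"
      then show "connector E C {A, P} (?k p) \<and> p \<in> ?k p"
        using inverse endpoint[of "?k p"] F_packing by (auto simp: packing_def)
    qed
  qed
qed

lemma rooted_linkage:
  assumes "sym E" "finite P" "packing E C {A, P} (card P) F" "C - P \<subseteq> D"
  obtains g where "disjoint_family_on g P"
    "\<forall>p\<in>P. connector E C {A} (g p) \<and> p \<in> g p \<and> g p \<subseteq> insert p (reach_within E D A)"
proof -
  obtain k where k_indexes: "disjoint_family_on k P" "\<forall>p\<in>P. connector E C {A, P} (k p) \<and> p \<in> k p"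
    using packing_index_by_endpoints[OF assms(3,2)] .
  have "\<exists>Y. Y \<subseteq> k p \<and> connector E C {A} Y \<and> p \<in> Y \<and> Y \<subseteq> insert p (reach_within E D A)"
    if p_mem: "p \<in> P" for p
  proof -
    have k_p: "connected_in E (k p)" "p \<in> k p" "k p \<inter> A \<noteq> {}" "k p \<subseteq> C"
      using bspec[OF k_indexes(2) p_mem] by (auto simp: connector_def)
    have "k p - {p} \<subseteq> C - P"
      using k_p(4) k_indexes p_mem disjoint_family_onD[OF k_indexes(1) p_mem] by blast
    then have "reach_within E (k p - {p}) A \<subseteq> reach_within E D A"
      using assms(4) by (intro reach_within_mono) auto
    moreover obtain Y where "Y \<subseteq> k p" "p \<in> Y" "connected_in E Y" "Y \<inter> A \<noteq> {}"
      "Y \<subseteq> insert p (reach_within E (k p - {p}) A)"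
      using connected_trim[OF assms(1) k_p(1-3)] .
    ultimately have "Y \<subseteq> k p \<and> connector E C {A} Y \<and> p \<in> Y \<and> Y \<subseteq> insert p (reach_within E D A)"
      using k_p(4) by (auto simp: connector_def)
    then show ?thesis by blast
  qed
  then obtain g where g_linkage: "\<And>p. p \<in> P \<Longrightarrow> g p \<subseteq> k p \<and> connector E C {A} (g p) \<and> p \<in> g p \<and>
      g p \<subseteq> insert p (reach_within E D A)" by metis
  moreover have "disjoint_family_on g P"
    using k_indexes(1) g_linkage unfolding disjoint_family_on_def by blast
  ultimately show ?thesis using that by blast
qed

lemma packing_Un_linkages:
  assumes "sym E" "finite P" "disjoint_family_on a P" "disjoint_family_on b P"
    and cross: "\<And>p q. p \<in> P \<Longrightarrow> q \<in> P \<Longrightarrow> p \<noteq> q \<Longrightarrow> a p \<inter> b q = {}"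
    and a_connector: "\<And>p. p \<in> P \<Longrightarrow> connector E C {A} (a p)"
    and b_connector: "\<And>p. p \<in> P \<Longrightarrow> connector E C {B} (b p)"
    and link: "\<And>p. p \<in> P \<Longrightarrow> \<exists>u\<in>a p. \<exists>v\<in>b p. u = v \<or> (u, v) \<in> E"
  shows "packing E C {A, B} (card P) ((\<lambda>p. a p \<union> b p) ` P)"
proof (rule packing_image[OF assms(2)])
  show "disjoint_family_on (\<lambda>p. a p \<union> b p) P"
    unfolding disjoint_family_on_def
  proof (intro ballI impI)
    fix p q assume distinct_pair: "p \<in> P" "q \<in> P" "p \<noteq> q"
    show "(a p \<union> b p) \<inter> (a q \<union> b q) = {}"
      using disjoint_family_onD[OF assms(3) distinct_pair]
        disjoint_family_onD[OF assms(4) distinct_pair]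
        cross[OF distinct_pair] cross[OF distinct_pair(2,1) distinct_pair(3)[symmetric]] by auto
  qed
  fix p assume p_mem: "p \<in> P"
  have connected_halves: "connected_in E (a p)" "connected_in E (b p)"
    using a_connector[OF p_mem] b_connector[OF p_mem] by (simp_all add: connector_def)
  obtain u v where "u \<in> a p" "v \<in> b p" "u = v \<or> (u, v) \<in> E" using link[OF p_mem] by blast
  then have "connected_in E (a p \<union> b p)"
    using connected_in_Un[OF connected_halves] connected_in_Un_edge[OF assms(1) connected_halves]
    by blast
  then show "connector E C {A, B} (a p \<union> b p)"
    using a_connector[OF p_mem] b_connector[OF p_mem] by (auto simp: connector_def)
qed

lemma packing_glue_along_edge:
  assumes "sym E" "sym E'" "E' \<subseteq> E" "finite S"
    and S_separates: "separates E' C {A, B} S"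
    and edge: "(x, y) \<in> E" "x \<in> reach_within E' (C - S) A" "y \<in> reach_within E' (C - S) B"
    and A_packing: "packing E' C {A, insert x S} (Suc (card S)) FA"
    and B_packing: "packing E' C {B, insert y S} (Suc (card S)) FB"
  shows "\<exists>F. packing E C {A, B} (Suc (card S)) F"
proof -
  let ?RA = "reach_within E' (C - S) A" and ?RB = "reach_within E' (C - S) B"
  let ?r = "\<lambda>p. if p = x then y else p"
  have sides_disjoint: "?RA \<inter> ?RB = {}" "?RA \<inter> S = {}" "?RB \<inter> S = {}"
    using reach_within_disjoint[OF assms(2) S_separates] reach_within_subset[of E' "C - S"]
    by blast+
  then have ends_notin: "x \<notin> S" "y \<notin> S" and "x \<noteq> y" using edge(2,3) by auto
  then have card_insert_end: "card (insert x S) = Suc (card S)" "card (insert y S) = Suc (card S)"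
    using assms(4) by auto
  obtain a where a_linkage: "disjoint_family_on a (insert x S)"
    "\<forall>p\<in>insert x S. connector E' C {A} (a p) \<and> p \<in> a p \<and> a p \<subseteq> insert p ?RA"
    using rooted_linkage[OF assms(2) _ A_packing[folded card_insert_end(1)], of "C - S"] assms(4)
    by auto
  obtain b where b_linkage: "disjoint_family_on b (insert y S)"
    "\<forall>p\<in>insert y S. connector E' C {B} (b p) \<and> p \<in> b p \<and> b p \<subseteq> insert p ?RB"
    using rooted_linkage[OF assms(2) _ B_packing[folded card_insert_end(2)], of "C - S"] assms(4)
    by auto
  have matched_end: "?r p \<in> insert y S" if "p \<in> insert x S" for p using that by auto
  have "packing E C {A, B} (card (insert x S)) ((\<lambda>p. a p \<union> b (?r p)) ` insert x S)"
  proof (rule packing_Un_linkages[OF assms(1) _ a_linkage(1)])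
    show "disjoint_family_on (\<lambda>p. b (?r p)) (insert x S)"
      unfolding disjoint_family_on_def
    proof (intro ballI impI)
      fix p q assume distinct_pair: "p \<in> insert x S" "q \<in> insert x S" "p \<noteq> q"
      then have "?r p \<noteq> ?r q" using ends_notin by auto
      then show "b (?r p) \<inter> b (?r q) = {}"
        by (rule disjoint_family_onD[OF b_linkage(1) matched_end[OF distinct_pair(1)]
              matched_end[OF distinct_pair(2)]])
    qed
    fix p assume p_mem: "p \<in> insert x S"
    have "insert p ?RA \<inter> insert (?r q) ?RB = {}" if "q \<in> insert x S" "p \<noteq> q" for q
      using p_mem that sides_disjoint edge(2,3) ends_notin \<open>x \<noteq> y\<close>
      by (cases "p = x"; cases "q = x") (auto simp: disjoint_iff)
    then show "a p \<inter> b (?r q) = {}" if "q \<in> insert x S" "p \<noteq> q" for q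
      using bspec[OF a_linkage(2) p_mem] bspec[OF b_linkage(2) matched_end[OF that(1)]] that
      by blast
    show "connector E C {A} (a p)" "connector E C {B} (b (?r p))"
      using bspec[OF a_linkage(2) p_mem] bspec[OF b_linkage(2) matched_end[OF p_mem]]
        connector_mono[OF _ order_refl assms(3)]
      by blast+
    have "p \<in> a p" "?r p \<in> b (?r p)"
      using bspec[OF a_linkage(2) p_mem] bspec[OF b_linkage(2) matched_end[OF p_mem]] by blast+
    then show "\<exists>u\<in>a p. \<exists>v\<in>b (?r p). u = v \<or> (u, v) \<in> E" using edge(1) by (cases "p = x") auto
  qed (use assms(4) in simp)
  then show ?thesis unfolding card_insert_end(1) by blast
qed

lemma menger_no_edges:
  assumes "finite C"
  shows "(\<exists>F. packing {} C {A, B} t F) \<or> (\<exists>Z. separates {} C {A, B} Z \<and> card Z < t)"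
proof (cases "t \<le> card (A \<inter> B \<inter> C)")
  case True
  then obtain T where T_subset: "T \<subseteq> A \<inter> B \<inter> C" "card T = t" "finite T"
    by (rule obtain_subset_with_card_n)
  have "packing {} C {A, B} (card T) ((\<lambda>v. {v}) ` T)"
    using T_subset by (intro packing_image) (auto simp: disjoint_family_on_def connector_def)
  then show ?thesis using T_subset(2) by blast
next
  case False
  have "reach_within {} (C - A \<inter> B \<inter> C) A \<subseteq> A \<inter> (C - A \<inter> B \<inter> C)"
    by (rule reach_within_least) (auto simp: closed_in_def)
  then have "separates {} C {A, B} (A \<inter> B \<inter> C)"
    by (auto simp: separates_iff_reach_within sym_def)
  then show ?thesis using False by auto
qed

lemma menger_add_edge:
  assumes "sym E" "sym E'" "(a, b) \<in> E" "E' = E - {(a, b), (b, a)}" "finite C"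
    and IH: "\<And>A B. (\<exists>F. packing E' C {A, B} t F) \<or> (\<exists>Z. separates E' C {A, B} Z \<and> card Z < t)"
  shows "(\<exists>F. packing E C {A, B} t F) \<or> (\<exists>Z. separates E C {A, B} Z \<and> card Z < t)"
proof (rule ccontr)
  assume none: "\<not> ?thesis"
  have "E' \<subseteq> E" using assms(4) by blast
  then obtain S where S_separates: "separates E' C {A, B} S" "card S < t"
    using IH[of A B] none packing_mono by blast
  have "S \<subseteq> C" using S_separates(1) by (simp add: separates_def)
  then have finite_S: "finite S" using assms(5) finite_subset by blast
  obtain x y where edge: "(x, y) \<in> E" and E_subset: "E \<subseteq> E' \<union> {(x, y), (y, x)}"
    and x_reached: "x \<in> reach_within E' (C - S) A" and y_reached: "y \<in> reach_within E' (C - S) B"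
    using deleted_edge_joins_sides[OF assms(1-4) S_separates(1)] none S_separates(2) by blast
  have x_side: "x \<notin> reach_within E' (C - S) B" and y_side: "y \<notin> reach_within E' (C - S) A"
    using reach_within_disjoint[OF assms(2) S_separates(1)] x_reached y_reached by blast+
  have x_lift: "separates E C {A, B} T" if "separates E' C {A, insert x S} T" for T
    using separates_deleted_edge[OF assms(1,2) E_subset S_separates(1) y_side that] .
  have y_lift: "separates E C {A, B} T" if "separates E' C {B, insert y S} T" for T
    using separates_deleted_edge[OF assms(1,2), of y x C B A S T]
      E_subset S_separates(1) x_side that
    by (simp add: insert_commute)
  have "x \<in> C - S" using x_reached reach_within_subset[of E' "C - S" A] by blast
  then have "separates E C {A, B} (insert x S)" using \<open>S \<subseteq> C\<close> by (intro x_lift separates_refl) auto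
  then have t_eq: "t = Suc (card S)"
    using none S_separates(2) finite_S \<open>x \<in> C - S\<close> by (auto simp: not_less)
  obtain FA where "packing E' C {A, insert x S} t FA" using IH none x_lift by metis
  moreover obtain FB where "packing E' C {B, insert y S} t FB" using IH none y_lift by metis
  ultimately show False
    using packing_glue_along_edge[OF assms(1,2) \<open>E' \<subseteq> E\<close> finite_S S_separates(1)
        edge x_reached y_reached] none
    unfolding t_eq by blast
qed

theorem menger:
  assumes "finite E" "sym E" "finite C"
  shows "(\<exists>F. packing E C {A, B} t F) \<or> (\<exists>Z. separates E C {A, B} Z \<and> card Z < t)"
  using assms(1,2)
proof (induction "card E" arbitrary: E A B rule: less_induct)
  case less
  show ?case
  proof (cases "E = {}")
    case True
    then show ?thesis using menger_no_edges[OF assms(3)] by simp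
  next
    case False
    then obtain a b where edge: "(a, b) \<in> E" by auto
    let ?E' = "E - {(a, b), (b, a)}"
    have "finite ?E'" "card ?E' < card E"
      using less.prems(1) edge by (auto intro!: psubset_card_mono)
    moreover have "sym ?E'" using less.prems(2) by (auto simp: sym_def)
    ultimately show ?thesis
      using menger_add_edge[OF less.prems(2) _ edge HOL.refl assms(3)] less.hyps[of ?E'] by blast
  qed
qed

section \<open>Pair graphs\<close>

lemma pair_graph_iff:
  "pair_graph G \<longleftrightarrow> finite (pverts G) \<and> parcs G \<subseteq> pverts G \<times> pverts G \<and>
     sym (parcs G) \<and> irrefl (parcs G)"
proof
  assume "pair_graph G"
  then interpret pair_graph G .
  show "finite (pverts G) \<and> parcs G \<subseteq> pverts G \<times> pverts G \<and> sym (parcs G) \<and> irrefl (parcs G)"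
    using pair_finite_verts pair_sym_arcs wellformed' pair_no_loops
    by (fastforce simp: symmetric_def irrefl_def)
next
  assume graph_conditions: "finite (pverts G) \<and> parcs G \<subseteq> pverts G \<times> pverts G \<and>
     sym (parcs G) \<and> irrefl (parcs G)"
  then have "finite (parcs G)" by (auto intro: finite_subset)
  then show "pair_graph G"
    using graph_conditions by unfold_locales (auto simp: symmetric_def irrefl_def)
qed

lemma digraph_connectedI:
  assumes "connected_in (arcs_ends H) (verts H)"
  shows "Digraph_Component.connected H"
  unfolding Digraph_Component.connected_def strongly_connected_def
proof (intro conjI ballI)
  let ?K = "with_proj (mk_symmetric H)"
  show "verts ?K \<noteq> {}" using connected_in_nonempty[OF assms] by simp
  have arcs: "arcs_ends H \<subseteq> arcs_ends ?K" by (auto simp: parcs_mk_symmetric arcs_ends_conv)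
  fix u v assume "u \<in> verts ?K" "v \<in> verts ?K"
  then have "(u, v) \<in> rtrancl_on (verts H) (arcs_ends H)"
    by (intro connected_inD[OF assms]) simp_all
  then show "u \<rightarrow>\<^sup>*\<^bsub>?K\<^esub> v"
    using rtrancl_on_mono[OF arcs order_refl] by (simp add: reachable_def)
qed

lemma connected_in_restrict: "connected_in E S \<Longrightarrow> connected_in (E \<inter> S \<times> S) S"
  using connected_in_image[of E S id "E \<inter> S \<times> S"] by simp

lemma digraph_connected_inducedI:
  assumes "connected_in (parcs T) B"
  shows "Digraph_Component.connected (with_proj T \<restriction> B)"
proof (rule digraph_connectedI)
  have "arcs_ends (with_proj T \<restriction> B) = parcs T \<inter> B \<times> B"
    by (auto simp: arcs_ends_conv induce_subgraph_def image_iff)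
  then show "connected_in (arcs_ends (with_proj T \<restriction> B)) (verts (with_proj T \<restriction> B))"
    using connected_in_restrict[OF assms] by simp
qed

lemma subgraph_with_projI:
  assumes "pverts S \<subseteq> pverts K" "parcs S \<subseteq> parcs K"
    and "parcs S \<subseteq> pverts S \<times> pverts S" "parcs K \<subseteq> pverts K \<times> pverts K"
  shows "subgraph (with_proj S) (with_proj K)"
  using assms unfolding subgraph_def compatible_def by (auto intro!: wf_digraph.intro)

lemma digraph_iso_image:
  assumes "inj_on g (pverts X)" "parcs X \<subseteq> pverts X \<times> pverts X"
    and "Y = \<lparr>pverts = g ` pverts X, parcs = map_prod g g ` parcs X\<rparr>"
  shows "digraph_iso (with_proj X) (with_proj Y)"
proof -
  let ?f = "\<lparr>iso_verts = g, iso_arcs = map_prod g g, iso_head = snd, iso_tail = fst\<rparr>"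
  have "inj_on (map_prod g g) (parcs X)"
    using map_prod_inj_on[OF assms(1,1)] assms(2) by (rule inj_on_subset)
  moreover have "wf_digraph (with_proj X)" using assms(2) by (auto intro!: wf_digraph.intro)
  ultimately have "pre_digraph.digraph_isomorphism (with_proj X) ?f"
    using assms(1) by (simp add: pre_digraph.digraph_isomorphism_def)
  moreover have "with_proj Y = app_iso ?f (with_proj X)"
    by (simp add: app_iso_def assms(3) with_proj_def)
  ultimately show ?thesis unfolding digraph_iso_def by blast
qed

lemma subgraph_up_to_isoI:
  assumes pair_graph_G: "pair_graph G" and K_wf: "parcs K \<subseteq> pverts K \<times> pverts K"
    and embedding: "inj_on \<phi> (pverts G)" "\<phi> ` pverts G \<subseteq> pverts K"
      "map_prod \<phi> \<phi> ` parcs G \<subseteq> parcs K"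
  shows "subgraph_up_to_iso G K"
proof -
  let ?S = "\<lparr>pverts = \<phi> ` pverts G, parcs = map_prod \<phi> \<phi> ` parcs G\<rparr>"
  have G_conditions: "finite (pverts G)" "parcs G \<subseteq> pverts G \<times> pverts G"
    "sym (parcs G)" "irrefl (parcs G)"
    using pair_graph_G by (auto simp: pair_graph_iff)
  have image_wf: "parcs ?S \<subseteq> pverts ?S \<times> pverts ?S" using G_conditions(2) by auto
  have "sym (parcs ?S)" using G_conditions(3) by (force simp: sym_def)
  moreover have "irrefl (parcs ?S)"
    using G_conditions(2,4) inj_onD[OF embedding(1)] by (fastforce simp: irrefl_def)
  ultimately have "pair_graph ?S" using G_conditions(1) image_wf unfolding pair_graph_iff by simp
  moreover have "subgraph (with_proj ?S) (with_proj K)"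
    using embedding(2,3) by (intro subgraph_with_projI image_wf K_wf) auto
  ultimately show ?thesis
    using digraph_iso_image[OF embedding(1) G_conditions(2) HOL.refl]
    unfolding subgraph_up_to_iso_def by blast
qed

section \<open>Minors from connected branch sets\<close>

definition quotient_graph :: "('a \<Rightarrow> 'b) \<Rightarrow> 'a pair_pre_digraph \<Rightarrow> 'b pair_pre_digraph" where
  "quotient_graph f G = \<lparr>pverts = f ` pverts G,
     parcs = {(f x, f y) | x y. (x, y) \<in> parcs G \<and> f x \<noteq> f y}\<rparr>"

definition contact_graph :: "'a rel \<Rightarrow> 'b set \<Rightarrow> ('b \<Rightarrow> 'a set) \<Rightarrow> 'b pair_pre_digraph" where
  "contact_graph E I B = \<lparr>pverts = I,
     parcs = {(i, j). i \<in> I \<and> j \<in> I \<and> i \<noteq> j \<and> E `` B i \<inter> B j \<noteq> {}}\<rparr>"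

definition clique_model :: "'a rel \<Rightarrow> 'b set \<Rightarrow> ('b \<Rightarrow> 'a set) \<Rightarrow> bool" where
  "clique_model E K B \<longleftrightarrow> disjoint_family_on B K \<and> (\<forall>i\<in>K. connected_in E (B i)) \<and>
     (\<forall>i\<in>K. \<forall>j\<in>K. i \<noteq> j \<longrightarrow> E `` B i \<inter> B j \<noteq> {})"

lemma contract_edge_eq_quotient_graph:
  "contract_edge G u v = quotient_graph (\<lambda>w. if w = v then u else w) G"
  by (simp add: contract_edge_def quotient_graph_def Let_def)

lemma pair_graph_quotient_graph: "pair_graph G \<Longrightarrow> pair_graph (quotient_graph f G)"
  unfolding pair_graph_iff quotient_graph_def sym_def irrefl_def by fastforce

lemma quotient_graph_comp: "quotient_graph f (quotient_graph h G) = quotient_graph (f \<circ> h) G"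
  unfolding quotient_graph_def by (auto simp: image_comp) metis

lemma digraph_iso_quotient_graph_inj:
  assumes "pair_graph G" "inj_on f (pverts G)"
  shows "digraph_iso (with_proj (quotient_graph f G)) (with_proj G)"
proof -
  let ?Q = "quotient_graph f G" and ?g = "inv_into (pverts G) f"
  have g_inverse: "?g (f x) = x" if "x \<in> pverts G" for x using assms(2) that by (rule inv_into_f_f)
  have G_conditions: "parcs G \<subseteq> pverts G \<times> pverts G" "irrefl (parcs G)"
    using assms(1) by (auto simp: pair_graph_iff)
  have arcs: "(x, y) \<in> parcs G \<Longrightarrow> x \<in> pverts G \<and> y \<in> pverts G \<and> f x \<noteq> f y" for x y
    using G_conditions inj_onD[OF assms(2)] by (force simp: irrefl_def)
  have quotient_arcs: "parcs ?Q = map_prod f f ` parcs G"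
    using arcs by (force simp: quotient_graph_def)
  have "?g ` pverts ?Q = pverts G" using g_inverse by (force simp: quotient_graph_def)
  moreover have "map_prod ?g ?g ` parcs ?Q = (\<lambda>e. e) ` parcs G"
    unfolding quotient_arcs image_image using g_inverse arcs by (intro image_cong) auto
  ultimately have "G = \<lparr>pverts = ?g ` pverts ?Q, parcs = map_prod ?g ?g ` parcs ?Q\<rparr>" by simp
  then show ?thesis
    by (rule digraph_iso_image[rotated 2])
      (use arcs in \<open>auto simp: quotient_graph_def inj_on_inv_into\<close>)
qed

lemma connected_fibres_contract_edge:
  assumes same_fibre: "u \<in> pverts S" "v \<in> pverts S" "f u = f v"
    and connected_fibres: "\<And>z. z \<in> pverts S \<Longrightarrow> connected_in (parcs S) {w \<in> pverts S. f w = f z}"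
    and z_mem: "z \<in> pverts (contract_edge S u v)"
  shows "connected_in (parcs (contract_edge S u v)) {w \<in> pverts (contract_edge S u v). f w = f z}"
proof -
  let ?h = "\<lambda>w. if w = v then u else w"
  have "connected_in (parcs (contract_edge S u v)) (?h ` {w \<in> pverts S. f w = f z})"
  proof (rule connected_in_image[OF connected_fibres])
    show "z \<in> pverts S"
      using z_mem same_fibre(1)
      by (auto simp: contract_edge_eq_quotient_graph quotient_graph_def split: if_splits)
    fix a b assume "(a, b) \<in> parcs S"
    then show "?h a = ?h b \<or> (?h a, ?h b) \<in> parcs (contract_edge S u v)"
      by (auto simp: contract_edge_eq_quotient_graph quotient_graph_def)
  qed
  moreover have "?h ` {w \<in> pverts S. f w = f z} = {w \<in> pverts (contract_edge S u v). f w = f z}"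
    using same_fibre(3) by (auto simp: contract_edge_eq_quotient_graph quotient_graph_def)
  ultimately show ?thesis by simp
qed

lemma contracts_to_quotient_graph:
  assumes "pair_graph S" "contracts_to G S"
    and "\<And>v. v \<in> pverts S \<Longrightarrow> connected_in (parcs S) {w \<in> pverts S. f w = f v}"
  shows "\<exists>Y. contracts_to G Y \<and> digraph_iso (with_proj (quotient_graph f S)) (with_proj Y)"
  using assms
proof (induction "card (pverts S)" arbitrary: S rule: less_induct)
  case less
  show ?case
  proof (cases "inj_on f (pverts S)")
    case True
    then show ?thesis using less.prems(1,2) digraph_iso_quotient_graph_inj by blast
  next
    case False
    then obtain x y where same_fibre: "x \<in> pverts S" "y \<in> pverts S" "x \<noteq> y" "f x = f y"
      by (auto simp: inj_on_def)
    obtain u v where crossing: "u \<in> {w \<in> pverts S. f w = f x}" "u \<in> {x}"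
        "v \<in> {w \<in> pverts S. f w = f x}" "v \<notin> {x}" "(u, v) \<in> parcs S"
      using connected_in_crossing[OF less.prems(3)[OF same_fibre(1)], of x "{x}" y] same_fibre
      by auto
    let ?S = "contract_edge S u v"
    have "pverts ?S = pverts S - {v}"
      using crossing by (auto simp: contract_edge_eq_quotient_graph quotient_graph_def)
    moreover have "finite (pverts S)" using less.prems(1) by (simp add: pair_graph_iff)
    ultimately have "card (pverts ?S) < card (pverts S)"
      using crossing(3) by (metis (no_types, lifting) card_Diff1_less mem_Collect_eq)
    moreover have "pair_graph ?S"
      using less.prems(1) by (simp add: contract_edge_eq_quotient_graph pair_graph_quotient_graph)
    moreover have "contracts_to G ?S" using less.prems(2) crossing(5) by (rule contracts_to.step)
    moreover have "connected_in (parcs ?S) {w \<in> pverts ?S. f w = f z}" if "z \<in> pverts ?S" for z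
      using connected_fibres_contract_edge[OF _ _ _ less.prems(3) that] crossing by simp
    ultimately obtain Y where "contracts_to G Y"
        "digraph_iso (with_proj (quotient_graph f ?S)) (with_proj Y)"
      using less.hyps[of ?S] by blast
    moreover have "f \<circ> (\<lambda>w. if w = v then u else w) = f" using crossing by auto
    then have "quotient_graph f ?S = quotient_graph f S"
      unfolding contract_edge_eq_quotient_graph quotient_graph_comp by simp
    ultimately show ?thesis by auto
  qed
qed

lemma minor_quotient_graph:
  assumes pair_graph_G: "pair_graph G" and "W \<subseteq> pverts G"
    and fibres: "\<And>v. v \<in> W \<Longrightarrow> connected_in (parcs G) {w \<in> W. f w = f v}"
  shows "minor (quotient_graph f \<lparr>pverts = W, parcs = parcs G \<inter> W \<times> W\<rparr>) G"
proof -
  let ?S = "\<lparr>pverts = W, parcs = parcs G \<inter> W \<times> W\<rparr>"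
  have pair_graph_S: "pair_graph ?S"
    using pair_graph_G assms(2)
    by (auto simp: pair_graph_iff sym_def irrefl_def intro: finite_subset)
  have "connected_in (parcs G \<inter> W \<times> W) {w \<in> W. f w = f v}" if "v \<in> W" for v
    by (rule connected_in_mono[OF connected_in_restrict[OF fibres[OF that]]]) auto
  then obtain Y where "contracts_to ?S Y"
    "digraph_iso (with_proj (quotient_graph f ?S)) (with_proj Y)"
    using contracts_to_quotient_graph[OF pair_graph_S contracts_to.refl, of f] by auto
  moreover have "subgraph (with_proj ?S) (with_proj G)"
    using pair_graph_G assms(2) by (intro subgraph_with_projI) (auto simp: pair_graph_iff)
  ultimately show ?thesis using pair_graph_S unfolding minor_def by blast
qed

lemma Image_Int_eq_empty_iff: "E `` X \<inter> Y = {} \<longleftrightarrow> (\<forall>x\<in>X. \<forall>y\<in>Y. (x, y) \<notin> E)"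
  by blast

lemma disjoint_family_on_index:
  assumes "disjoint_family_on B I"
  shows "\<exists>f. \<forall>i\<in>I. \<forall>v\<in>B i. f v = i"
proof -
  have "(THE i. i \<in> I \<and> v \<in> B i) = i" if "i \<in> I" "v \<in> B i" for i v
    using assms that by (auto simp: disjoint_family_on_def)
  then show ?thesis by (intro exI[of _ "\<lambda>v. THE i. i \<in> I \<and> v \<in> B i"]) simp
qed

lemma disjoint_family_on_If:
  assumes "disjoint_family_on A I" "disjoint_family_on B J"
    and "\<And>i j. i \<in> I \<Longrightarrow> j \<in> J \<Longrightarrow> A i \<inter> B j = {}"
  shows "disjoint_family_on (\<lambda>i. if i \<in> I then A i else B i) (I \<union> J)"
  unfolding disjoint_family_on_def
proof (intro ballI impI)
  fix i j assume "i \<in> I \<union> J" "j \<in> I \<union> J" "i \<noteq> j"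
  then show "(if i \<in> I then A i else B i) \<inter> (if j \<in> I then A j else B j) = {}"
    using assms(3)[of i j] assms(3)[of j i] disjoint_family_onD[OF assms(1), of i j]
      disjoint_family_onD[OF assms(2), of i j] by (auto simp: Int_commute)
qed

lemma minor_contact_graph:
  assumes "pair_graph G" "disjoint_family_on B I"
    and branch_sets: "\<And>i. i \<in> I \<Longrightarrow> B i \<subseteq> pverts G \<and> connected_in (parcs G) (B i)"
  shows "minor (contact_graph (parcs G) I B) G"
proof -
  let ?W = "\<Union>i\<in>I. B i"
  obtain f where f_index: "\<And>i v. i \<in> I \<Longrightarrow> v \<in> B i \<Longrightarrow> f v = i"
    using disjoint_family_on_index[OF assms(2)] by blast
  have fibre: "{w \<in> ?W. f w = i} = B i" if "i \<in> I" for i using f_index that by auto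
  have nonempty: "\<exists>v. v \<in> B i" if "i \<in> I" for i
    using connected_in_nonempty branch_sets[OF that] by blast
  have "f ` ?W = I"
  proof
    show "I \<subseteq> f ` ?W" using f_index nonempty by (metis UN_I image_eqI subsetI)
  qed (use f_index in auto)
  moreover have "{(f x, f y) | x y. (x, y) \<in> parcs G \<inter> ?W \<times> ?W \<and> f x \<noteq> f y} =
      {(i, j). i \<in> I \<and> j \<in> I \<and> i \<noteq> j \<and> parcs G `` B i \<inter> B j \<noteq> {}}" (is "?L = ?R")
  proof
    show "?L \<subseteq> ?R" using f_index by (auto simp: Image_Int_eq_empty_iff)
    show "?R \<subseteq> ?L"
    proof
      fix e assume "e \<in> ?R"
      then obtain i j x y where "e = (i, j)" "i \<in> I" "j \<in> I" "i \<noteq> j"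
        "x \<in> B i" "y \<in> B j" "(x, y) \<in> parcs G" by auto
      then have "e = (f x, f y) \<and> (x, y) \<in> parcs G \<inter> ?W \<times> ?W \<and> f x \<noteq> f y" using f_index by auto
      then show "e \<in> ?L" by blast
    qed
  qed
  ultimately have "contact_graph (parcs G) I B =
      quotient_graph f \<lparr>pverts = ?W, parcs = parcs G \<inter> ?W \<times> ?W\<rparr>"
    by (simp add: contact_graph_def quotient_graph_def)
  moreover have "connected_in (parcs G) {w \<in> ?W. f w = f v}" if v_mem: "v \<in> ?W" for v
  proof -
    obtain i where i_mem: "i \<in> I" "v \<in> B i" using v_mem by blast
    then show ?thesis unfolding f_index[OF i_mem] fibre[OF i_mem(1)] using branch_sets by blast
  qed
  ultimately show ?thesis using minor_quotient_graph[OF assms(1), of ?W f] branch_sets by auto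
qed

lemma contact_graph_in_J_class:
  assumes "sym E" "finite K" "finite L" "K \<inter> L = {}" "clique_model E K B"
    and join: "\<And>i j. i \<in> K \<Longrightarrow> j \<in> L \<Longrightarrow> E `` B i \<inter> B j \<noteq> {}"
    and L_family: "disjoint_family_on B L" "\<And>j. j \<in> L \<Longrightarrow> B j \<noteq> {}" "connected_in E (\<Union>j\<in>L. B j)"
  shows "contact_graph E (K \<union> L) B \<in> J_class (card K) (card L)"
proof -
  let ?X = "contact_graph E (K \<union> L) B"
  have "E `` B j \<inter> B i \<noteq> {}" if "E `` B i \<inter> B j \<noteq> {}" for i j
    using that symD[OF assms(1)] by blast
  then have "pair_graph ?X"
    using assms(2,3) by (auto simp: pair_graph_iff contact_graph_def sym_def irrefl_def)
  moreover have "\<forall>x\<in>K. \<forall>y\<in>K. x \<noteq> y \<longrightarrow> (x, y) \<in> parcs ?X"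
    using assms(5) by (simp add: contact_graph_def clique_model_def)
  moreover have "\<forall>x\<in>K. \<forall>y\<in>L. (x, y) \<in> parcs ?X"
    using join assms(4) by (fastforce simp: contact_graph_def)
  moreover have "connected_in (parcs ?X) L"
  proof -
    obtain f where f_index: "\<And>j v. j \<in> L \<Longrightarrow> v \<in> B j \<Longrightarrow> f v = j"
      using disjoint_family_on_index[OF L_family(1)] by blast
    have "connected_in (parcs ?X) (f ` (\<Union>j\<in>L. B j))"
    proof (rule connected_in_image[OF L_family(3)])
      fix u v assume "u \<in> (\<Union>j\<in>L. B j)" "v \<in> (\<Union>j\<in>L. B j)" "(u, v) \<in> E"
      then show "f u = f v \<or> (f u, f v) \<in> parcs ?X"
        using f_index by (auto simp: contact_graph_def Image_Int_eq_empty_iff)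
    qed
    moreover have "f ` (\<Union>j\<in>L. B j) = L" using f_index L_family(2) by force
    ultimately show ?thesis by simp
  qed
  ultimately show ?thesis
    unfolding J_class_def using assms(4) digraph_connected_inducedI[of ?X L]
    by (intro CollectI conjI exI[of _ K] exI[of _ L]) (simp_all add: contact_graph_def)
qed

lemma connected_family_grow:
  assumes "sym E" "connected_in E C" "I \<noteq> {}" "\<not> C \<subseteq> (\<Union>i\<in>I. Y i)"
    and Y_connected: "\<And>i. i \<in> I \<Longrightarrow> Y i \<subseteq> C \<and> connected_in E (Y i)"
  obtains k v where "k \<in> I" "v \<in> C - (\<Union>i\<in>I. Y i)" "connected_in E (insert v (Y k))"
proof -
  let ?U = "\<Union>i\<in>I. Y i"
  obtain i where "i \<in> I" using assms(3) by blast
  then obtain x where "x \<in> C" "x \<in> ?U"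
    using Y_connected[of i] connected_in_nonempty[of E "Y i"] by blast
  moreover obtain y where "y \<in> C" "y \<notin> ?U" using assms(4) by blast
  ultimately obtain u v where crossing: "u \<in> C" "u \<in> ?U" "v \<in> C" "v \<notin> ?U" "(u, v) \<in> E"
    by (rule connected_in_crossing[OF assms(2)])
  then obtain k where "k \<in> I" "u \<in> Y k" by blast
  then show ?thesis
    using that connected_in_insert[OF assms(1) _ _ crossing(5)] Y_connected crossing(3,4) by blast
qed

lemma extend_to_connected_partition:
  assumes "sym E" "finite C" "connected_in E C" "I \<noteq> {}"
    and "\<And>i. i \<in> I \<Longrightarrow> Y i \<subseteq> C \<and> connected_in E (Y i)" "disjoint_family_on Y I"
  obtains Z where "disjoint_family_on Z I" "(\<Union>i\<in>I. Z i) = C"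
    "\<And>i. i \<in> I \<Longrightarrow> Y i \<subseteq> Z i" "\<And>i. i \<in> I \<Longrightarrow> connected_in E (Z i)"
  using assms(5,6)
proof (induction "card (C - (\<Union>i\<in>I. Y i))" arbitrary: Y thesis rule: less_induct)
  case less
  let ?U = "\<Union>i\<in>I. Y i"
  show ?case
  proof (cases "C \<subseteq> ?U")
    case True
    then show ?thesis using less.prems by (intro less.prems(1)[of Y]) auto
  next
    case False
    obtain k v where grown: "k \<in> I" "v \<in> C - ?U" "connected_in E (insert v (Y k))"
      by (rule connected_family_grow[OF assms(1,3,4) False less.prems(2)])
    define Y' where "Y' = Y(k := insert v (Y k))"
    have "C - (\<Union>i\<in>I. Y' i) \<subset> C - ?U" using grown by (auto simp: Y'_def)
    then have "card (C - (\<Union>i\<in>I. Y' i)) < card (C - ?U)"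
      using assms(2) by (intro psubset_card_mono) auto
    moreover have "Y' i \<subseteq> C \<and> connected_in E (Y' i)" if "i \<in> I" for i
      using that less.prems(2)[OF that] less.prems(2)[OF grown(1)] grown(2,3) by (simp add: Y'_def)
    moreover have "disjoint_family_on Y' I"
      using less.prems(3) grown(2) unfolding disjoint_family_on_def Y'_def by auto
    ultimately obtain Z where Z_partition: "disjoint_family_on Z I" "(\<Union>i\<in>I. Z i) = C"
      "\<And>i. i \<in> I \<Longrightarrow> Y' i \<subseteq> Z i" "\<And>i. i \<in> I \<Longrightarrow> connected_in E (Z i)"
      using less.hyps[of Y'] by blast
    have "Y i \<subseteq> Z i" if "i \<in> I" for i
      using Z_partition(3)[OF that] by (auto simp: Y'_def split: if_splits)
    then show ?thesis using Z_partition by (intro less.prems(1)[of Z]) auto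
  qed
qed

lemma packing_partition:
  assumes "sym E" "finite C" "connected_in E C" "packing E C \<A> t F" "finite I" "card I = t" "t \<ge> 1"
  obtains Z where "disjoint_family_on Z I" "(\<Union>i\<in>I. Z i) = C" "\<And>i. i \<in> I \<Longrightarrow> connector E C \<A> (Z i)"
proof -
  obtain b where enumeration: "bij_betw b I F"
    using finite_same_card_bij[of I F] assms(4-6) by (auto simp: packing_def)
  have b_connector: "connector E C \<A> (b i)" if "i \<in> I" for i
    using bij_betwE[OF enumeration] that assms(4) by (simp add: packing_def)
  have "disjoint_family_on b I"
    using disjoint_image_disjoint_family_on[of b I] enumeration assms(4)
    by (auto simp: bij_betw_def packing_def)
  then obtain Z where Z_partition: "disjoint_family_on Z I" "(\<Union>i\<in>I. Z i) = C"
    "\<And>i. i \<in> I \<Longrightarrow> b i \<subseteq> Z i" "\<And>i. i \<in> I \<Longrightarrow> connected_in E (Z i)"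
    using extend_to_connected_partition[OF assms(1-3), of I b] b_connector assms(6,7)
    unfolding connector_def by (metis card.empty not_one_le_zero)
  have "connector E C \<A> (Z i)" if "i \<in> I" for i
    using Z_partition(3)[OF that] Z_partition(4)[OF that] Z_partition(2) b_connector[OF that] that
    unfolding connector_def by blast
  then show ?thesis using that Z_partition(1,2) by blast
qed

lemma not_J_minor_free_if_packing:
  fixes K :: "nat set"
  assumes pair_graph_G: "pair_graph G" and "t \<ge> 1" "finite K"
    and B_model: "clique_model (parcs G) K B"
    and B_subset: "\<And>i. i \<in> K \<Longrightarrow> B i \<subseteq> pverts G - C"
    and C_component: "C \<subseteq> pverts G" "connected_in (parcs G) C"
    and F_packing: "packing (parcs G) C ((\<lambda>i. parcs G `` B i) ` K) t F"
  shows "\<not> J_minor_free (card K) t G"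
proof -
  let ?E = "parcs G"
  have sym_E: "sym ?E" and "finite C"
    using pair_graph_G C_component(1) by (auto simp: pair_graph_iff intro: finite_subset)
  obtain N where N_bound: "K \<subseteq> {..<N}" using assms(3) finite_nat_iff_bounded by blast
  let ?L = "{N..<N + t}"
  obtain Z where Z_partition: "disjoint_family_on Z ?L" "(\<Union>j\<in>?L. Z j) = C"
    "\<And>j. j \<in> ?L \<Longrightarrow> connector ?E C ((\<lambda>i. ?E `` B i) ` K) (Z j)"
    using packing_partition[OF sym_E \<open>finite C\<close> C_component(2) F_packing, of ?L] assms(2) by auto
  let ?B = "\<lambda>i. if i \<in> K then B i else Z i"
  have K_L_disjoint: "K \<inter> ?L = {}" using N_bound by auto
  have on_L: "?B j = Z j" if "j \<in> ?L" for j using that K_L_disjoint by auto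
  have Z_subset: "Z j \<subseteq> C" if "j \<in> ?L" for j
    using Z_partition(3)[OF that] by (simp add: connector_def)
  have "disjoint_family_on ?B (K \<union> ?L)"
    using disjoint_family_on_If[of B K Z ?L] B_model Z_partition(1) B_subset Z_subset
    unfolding clique_model_def by blast
  then have "minor (contact_graph ?E (K \<union> ?L) ?B) G"
  proof (rule minor_contact_graph[OF pair_graph_G])
    fix i assume "i \<in> K \<union> ?L"
    then show "?B i \<subseteq> pverts G \<and> connected_in ?E (?B i)"
      using B_model B_subset[of i] Z_subset[of i] Z_partition(3)[of i] C_component(1)
      by (auto simp: clique_model_def connector_def)
  qed
  moreover have "contact_graph ?E (K \<union> ?L) ?B \<in> J_class (card K) (card ?L)"
  proof (rule contact_graph_in_J_class[OF sym_E assms(3) _ K_L_disjoint])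
    show "clique_model ?E K ?B" using B_model by (simp add: clique_model_def disjoint_family_on_def)
    show "?E `` ?B i \<inter> ?B j \<noteq> {}" if "i \<in> K" "j \<in> ?L" for i j
      using Z_partition(3)[OF that(2)] on_L[OF that(2)] that(1)
      by (simp add: connector_def Int_commute)
    show "disjoint_family_on ?B ?L" using Z_partition(1) on_L by (simp add: disjoint_family_on_def)
    show "?B j \<noteq> {}" if "j \<in> ?L" for j
      using connector_nonempty[OF Z_partition(3)[OF that]] on_L[OF that] by simp
    show "connected_in ?E (\<Union>j\<in>?L. ?B j)" using C_component(2) Z_partition(2) on_L by simp
  qed simp
  ultimately show ?thesis unfolding J_minor_free_def by auto
qed

section \<open>Treewidth of perfect elimination orders\<close>

lemma (in wf_digraph) cycle_two_neighbours:
  assumes long_cycle: "cycle c" "length c \<ge> 3" and w_mem: "w \<in> head G ` set c"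
  obtains x y where "x \<in> head G ` set c" "y \<in> head G ` set c" "x \<noteq> y"
    "x \<rightarrow>\<^bsub>G\<^esub> w" "w \<rightarrow>\<^bsub>G\<^esub> y"
proof -
  obtain u where u_walk: "awalk u c u" "distinct (tl (awalk_verts u c))"
    using long_cycle(1) by (auto simp: cycle_def)
  have verts: "awalk_verts u c = tail G (hd c) # map (head G) c"
    using awalk_verts_conv'[of u c u] u_walk(1) long_cycle(2) by (auto simp: awalk_def)
  then have "w \<in> set (awalk_verts u c)" using w_mem by auto
  with u_walk(1) obtain q r where rotation: "c = q @ r" "awalk w (r @ q) w" by (rule rotate_awalkE)
  define c' where "c' = r @ q"
  have rotated_cycle: "awalk w c' w" "set c' = set c" "length c' \<ge> 3" "distinct (map (head G) c')"
    using rotation long_cycle(2) u_walk(2) verts by (auto simp: c'_def)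
  obtain e d where split_first: "c' = e # d" "length d \<ge> 2"
    using rotated_cycle(3) by (cases c') auto
  obtain d' l where split_last: "d = d' @ [l]" "length d' \<ge> 1"
    using split_first(2) by (cases d rule: rev_cases) auto
  obtain d'' k where "d' = d'' @ [k]" using split_last(2) by (cases d' rule: rev_cases) auto
  then have rotated: "c' = e # d'' @ [k, l]" using split_first(1) split_last(1) by simp
  have walk: "tail G e = w" "head G k = tail G l" "head G l = w" "e \<in> arcs G" "l \<in> arcs G"
    using rotated_cycle(1) unfolding rotated by (auto simp: awalk_def)
  have "head G e \<noteq> tail G l" using rotated_cycle(4) unfolding rotated walk(2)[symmetric] by auto
  moreover have "tail G l \<in> head G ` set c" "head G e \<in> head G ` set c"
    unfolding rotated_cycle(2)[symmetric] rotated walk(2)[symmetric] by auto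
  moreover have "tail G l \<rightarrow>\<^bsub>G\<^esub> w" "w \<rightarrow>\<^bsub>G\<^esub> head G e"
    using in_arcs_imp_in_arcs_ends[OF walk(4)] in_arcs_imp_in_arcs_ends[OF walk(5)] walk(1,3)
    by auto
  ultimately show ?thesis using that by metis
qed

definition parent_graph :: "nat \<Rightarrow> (nat \<Rightarrow> nat) \<Rightarrow> nat pair_pre_digraph" where
  "parent_graph N p = \<lparr>pverts = {..<N},
     parcs = {(i, j). i < N \<and> j < N \<and> (0 < j \<and> i = p j \<or> 0 < i \<and> j = p i)}\<rparr>"

lemma sym_parent_graph: "sym (parcs (parent_graph N p))"
  by (auto simp: parent_graph_def sym_def)

lemma connected_in_parent_graph:
  assumes parent_less: "\<And>i. 0 < i \<Longrightarrow> i < N \<Longrightarrow> p i < i"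
    and S_closed: "S \<subseteq> {..<N}" "r \<in> S" "\<And>x. x \<in> S \<Longrightarrow> x \<noteq> r \<Longrightarrow> 0 < x \<and> p x \<in> S"
  shows "connected_in (parcs (parent_graph N p)) S"
proof (rule connected_in_rootI[OF sym_parent_graph S_closed(2)])
  let ?E = "parcs (parent_graph N p)"
  fix x assume "x \<in> S"
  then show "(r, x) \<in> rtrancl_on S ?E"
  proof (induction x rule: less_induct)
    case (less x)
    show ?case
    proof (cases "x = r")
      case True
      then show ?thesis using S_closed(2) by simp
    next
      case False
      then have x_facts: "0 < x" "p x \<in> S" "x < N" "p x < N" using S_closed less.prems by auto
      then have "(r, p x) \<in> rtrancl_on S ?E" using less.IH parent_less by blast
      moreover have "(p x, x) \<in> ?E" using x_facts by (simp add: parent_graph_def)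
      ultimately show ?thesis using less.prems by (rule rtrancl_on_into_rtrancl_on)
    qed
  qed
qed

lemma undirected_tree_parent_graph:
  assumes N_pos: "N \<ge> 1" and parent_less: "\<And>i. 0 < i \<Longrightarrow> i < N \<Longrightarrow> p i < i"
  shows "undirected_tree (parent_graph N p)"
proof -
  let ?T = "parent_graph N p"
  have "irrefl (parcs ?T)"
    using parent_less by (auto simp: parent_graph_def irrefl_def) (metis less_irrefl)
  then have pair_graph_T: "pair_graph ?T"
    using sym_parent_graph unfolding pair_graph_iff by (auto simp: parent_graph_def)
  then interpret pair_graph ?T .
  have "connected_in (parcs ?T) {..<N}"
  proof (rule connected_in_parent_graph[OF parent_less])
    show "0 \<in> {..<N}" using N_pos by simp
    show "0 < x \<and> p x \<in> {..<N}" if "x \<in> {..<N}" "x \<noteq> 0" for x using that parent_less[of x] by simp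
  qed auto
  then have "Digraph_Component.connected (with_proj ?T)"
    by (intro digraph_connectedI) (simp add: parent_graph_def)
  moreover have False if long_cycle: "cycle c" "length c \<ge> 3" for c
  proof -
    let ?M = "Max (snd ` set c)"
    have Max_mem: "?M \<in> snd ` set c" using long_cycle(2) by (intro Max_in) auto
    obtain x y where neighbours: "x \<in> snd ` set c" "y \<in> snd ` set c" "x \<noteq> y"
      "(x, ?M) \<in> parcs ?T" "(?M, y) \<in> parcs ?T"
      by (rule cycle_two_neighbours[OF long_cycle, unfolded with_proj_simps, OF Max_mem])
    have parent: "z = p ?M" if "z \<in> snd ` set c" "(z, ?M) \<in> parcs ?T" for z
    proof -
      have "z \<le> ?M" using that(1) by (intro Max_ge) auto
      then show ?thesis using that(2) parent_less[of z] by (auto simp: parent_graph_def)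
    qed
    show False
      using parent[OF neighbours(1,4)]
        parent[OF neighbours(2) symD[OF sym_parent_graph neighbours(5)]] neighbours(3)
      by simp
  qed
  ultimately show ?thesis using pair_graph_T unfolding undirected_tree_def by blast
qed

definition ordered_clique :: "(nat \<Rightarrow> nat set) \<Rightarrow> nat set \<Rightarrow> bool" where
  "ordered_clique P K \<longleftrightarrow> (\<forall>i\<in>K. \<forall>j\<in>K. i < j \<longrightarrow> i \<in> P j)"

definition elimination_order :: "nat \<Rightarrow> nat \<Rightarrow> (nat \<Rightarrow> nat set) \<Rightarrow> bool" where
  "elimination_order s N P \<longleftrightarrow> (\<forall>i<N. P i \<subseteq> {..<i} \<and> card (P i) \<le> s \<and> ordered_clique P (P i))"

definition elimination_graph :: "nat \<Rightarrow> (nat \<Rightarrow> nat set) \<Rightarrow> nat pair_pre_digraph" where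
  "elimination_graph N P =
    \<lparr>pverts = {..<N}, parcs = {(i, j). i < N \<and> j < N \<and> (i \<in> P j \<or> j \<in> P i)}\<rparr>"

lemma pair_graph_elimination_graph:
  "elimination_order s N P \<Longrightarrow> pair_graph (elimination_graph N P)"
  unfolding pair_graph_iff elimination_graph_def elimination_order_def sym_def irrefl_def by auto

lemma ordered_clique_upd:
  assumes "K \<subseteq> {..<N}"
  shows "ordered_clique (P(N := L)) K \<longleftrightarrow> ordered_clique P K"
proof -
  have "j \<noteq> N" if "j \<in> K" for j using assms that by auto
  then show ?thesis by (auto simp: ordered_clique_def)
qed

lemma ordered_clique_mono: "ordered_clique P L \<Longrightarrow> K \<subseteq> L \<Longrightarrow> ordered_clique P K"
  by (auto simp: ordered_clique_def)

lemma ordered_clique_insert_last: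
  assumes "ordered_clique P K" "K \<subseteq> {..<N}"
  shows "ordered_clique (P(N := K)) (insert N K)"
  unfolding ordered_clique_def
proof (intro ballI impI)
  fix i j assume ij_mem: "i \<in> insert N K" "j \<in> insert N K" "i < j"
  then have "i \<in> K" using assms(2) by auto
  then show "i \<in> (P(N := K)) j"
    using ij_mem assms(1) by (cases "j = N") (simp_all add: ordered_clique_def)
qed

lemma elimination_order_Suc:
  assumes P_order: "elimination_order s N P"
    and K_clique: "K \<subseteq> {..<N}" "card K \<le> s" "ordered_clique P K"
  shows "elimination_order s (Suc N) (P(N := K))"
  unfolding elimination_order_def
proof (intro allI impI)
  fix i assume i_less: "i < Suc N"
  show "(P(N := K)) i \<subseteq> {..<i} \<and> card ((P(N := K)) i) \<le> s \<and>
     ordered_clique (P(N := K)) ((P(N := K)) i)"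
  proof (cases "i = N")
    case True
    then show ?thesis using K_clique ordered_clique_upd[OF K_clique(1)] by simp
  next
    case False
    then have earlier: "P i \<subseteq> {..<i}" "card (P i) \<le> s" "ordered_clique P (P i)"
      using P_order i_less by (auto simp: elimination_order_def)
    then have "P i \<subseteq> {..<N}" using i_less by auto
    then show ?thesis using earlier False ordered_clique_upd by simp
  qed
qed

lemma treewidth_le_td_width:
  fixes T :: "nat pair_pre_digraph"
  assumes "tree_decomposition G T \<beta>"
  shows "treewidth G \<le> td_width T \<beta>"
  unfolding treewidth_def
proof (rule cInf_lower)
  show "bdd_below {td_width T \<beta> | (T :: nat pair_pre_digraph) \<beta>. tree_decomposition G T \<beta>}"
    by (rule bdd_belowI[of _ "-1"]) (auto simp: td_width_def)
qed (use assms in blast)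

text \<open>The bag of \<open>i\<close> is \<open>i\<close> with its earlier neighbours, and \<open>i\<close> hangs below the last of these.\<close>

lemma tree_decomposition_elimination_graph:
  assumes P_order: "elimination_order s N P" and N_pos: "N \<ge> 1"
  shows "tree_decomposition (elimination_graph N P)
    (parent_graph N (\<lambda>i. if P i = {} then 0 else Max (P i))) (\<lambda>i. insert i (P i))"
proof -
  let ?H = "elimination_graph N P" and ?p = "\<lambda>i. if P i = {} then 0 else Max (P i)"
  let ?T = "parent_graph N ?p"
  have earlier: "P i \<subseteq> {..<i}" "ordered_clique P (P i)" if "i < N" for i
    using P_order that by (auto simp: elimination_order_def)
  have finite_earlier: "finite (P i)" if "i < N" for i
    using finite_subset[OF earlier(1)[OF that]] by simp
  have Max_mem: "Max (P i) \<in> P i" if "i < N" "P i \<noteq> {}" for i using finite_earlier that by simp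
  have parent_less: "?p i < i" if "0 < i" "i < N" for i
    using Max_mem[OF that(2)] earlier(1)[OF that(2)] that(1) by auto
  have "connected_in (parcs ?T) {x \<in> pverts ?T. v \<in> insert x (P x)}" if v_less: "v < N" for v
  proof (rule connected_in_parent_graph[OF parent_less])
    fix x assume "x \<in> {x \<in> pverts ?T. v \<in> insert x (P x)}" "x \<noteq> v"
    then have x_mem: "x < N" "v \<in> P x" by (auto simp: parent_graph_def)
    then have parent_x: "0 < x" "?p x = Max (P x)" using earlier(1)[OF x_mem(1)] by auto
    have "v \<le> Max (P x)" using x_mem(2) finite_earlier[OF x_mem(1)] by simp
    moreover have "Max (P x) \<in> P x" using x_mem Max_mem by auto
    ultimately have "v = Max (P x) \<or> v \<in> P (Max (P x))"
      using earlier(2)[OF x_mem(1)] x_mem(2)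
      unfolding ordered_clique_def by (metis le_neq_implies_less)
    then show "0 < x \<and> ?p x \<in> {x \<in> pverts ?T. v \<in> insert x (P x)}"
      using parent_x parent_less[of x] x_mem(1) by (auto simp: parent_graph_def)
  qed (use v_less in \<open>auto simp: parent_graph_def\<close>)
  then have "\<forall>v\<in>pverts ?H.
      Digraph_Component.connected (with_proj ?T \<restriction> {x \<in> pverts ?T. v \<in> insert x (P x)})"
    by (auto simp: elimination_graph_def intro!: digraph_connected_inducedI)
  moreover have "\<forall>x\<in>pverts ?T. insert x (P x) \<subseteq> pverts ?H"
    using earlier(1) by (fastforce simp: parent_graph_def elimination_graph_def)
  moreover have "\<forall>(u, v)\<in>parcs ?H. \<exists>x\<in>pverts ?T. u \<in> insert x (P x) \<and> v \<in> insert x (P x)"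
    by (auto simp: parent_graph_def elimination_graph_def)
  ultimately show ?thesis
    unfolding tree_decomposition_def
    using undirected_tree_parent_graph[OF N_pos parent_less] by blast
qed

lemma treewidth_elimination_graph:
  assumes P_order: "elimination_order s N P" and N_pos: "N \<ge> 1"
  shows "treewidth (elimination_graph N P) \<le> int s"
proof -
  have "card (insert i (P i)) \<le> Suc s" if "i < N" for i
    using P_order that by (auto simp: elimination_order_def card_insert_if finite_subset)
  then have "Max ((\<lambda>i. card (insert i (P i))) ` {..<N}) \<le> Suc s"
    using N_pos by (subst Max_le_iff) (auto simp: lessThan_empty_iff)
  then have "td_width (parent_graph N p) (\<lambda>i. insert i (P i)) \<le> int s" for p
    by (simp add: td_width_def parent_graph_def)
  then show ?thesis
    using treewidth_le_td_width[OF tree_decomposition_elimination_graph[OF assms]] order_trans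
    by blast
qed

section \<open>Partitions into vertices of a graph and strong products\<close>

definition H_partition ::
  "'a rel \<Rightarrow> 'a set \<Rightarrow> 'b pair_pre_digraph \<Rightarrow> nat \<Rightarrow> ('a \<Rightarrow> 'b) \<Rightarrow> bool" where
  "H_partition E W H M f \<longleftrightarrow> f ` W \<subseteq> pverts H \<and> (\<forall>i. card {v \<in> W. f v = i} \<le> M) \<and>
     (\<forall>u\<in>W. \<forall>v\<in>W. (u, v) \<in> E \<longrightarrow> f u = f v \<or> (f u, f v) \<in> parcs H)"

lemma ex_injective_pairing:
  assumes "finite V" "\<And>i. card {v \<in> V. f v = i} \<le> M"
  shows "\<exists>g. inj_on (\<lambda>v. (f v, g v)) V \<and> g ` V \<subseteq> {..<M}"
proof -
  have "\<exists>h. h ` {v \<in> V. f v = i} \<subseteq> {..<M} \<and> inj_on h {v \<in> V. f v = i}" for i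
    using assms by (intro card_le_inj) auto
  then obtain h where
    fibre_injection: "\<And>i. h i ` {v \<in> V. f v = i} \<subseteq> {..<M}"
      "\<And>i. inj_on (h i) {v \<in> V. f v = i}"
    by metis
  have "inj_on (\<lambda>v. (f v, h (f v) v)) V"
    using inj_onD[OF fibre_injection(2)] by (auto intro!: inj_onI)
  moreover have "(\<lambda>v. h (f v) v) ` V \<subseteq> {..<M}" using fibre_injection(1) by auto
  ultimately show ?thesis by (intro exI[of _ "\<lambda>v. h (f v) v"] conjI)
qed

lemma subgraph_up_to_iso_strong_product:
  assumes pair_graph_G: "pair_graph G" and f_partition: "H_partition (parcs G) (pverts G) H M f"
  shows "subgraph_up_to_iso G (H \<boxtimes> complete_graph M)"
proof -
  have G_conditions: "finite (pverts G)" "parcs G \<subseteq> pverts G \<times> pverts G" "irrefl (parcs G)"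
    using pair_graph_G by (auto simp: pair_graph_iff)
  obtain g where g_injective: "inj_on (\<lambda>v. (f v, g v)) (pverts G)" "g ` pverts G \<subseteq> {..<M}"
    using ex_injective_pairing[OF G_conditions(1), of f M] f_partition
    by (auto simp: H_partition_def)
  let ?\<phi> = "\<lambda>v. (f v, g v)" and ?K = "H \<boxtimes> complete_graph M"
  have verts: "?\<phi> ` pverts G \<subseteq> pverts ?K"
    using f_partition g_injective(2)
    by (auto simp: H_partition_def strong_product_def complete_graph_def)
  have "(?\<phi> u, ?\<phi> v) \<in> parcs ?K" if edge: "(u, v) \<in> parcs G" for u v
  proof -
    have "u \<in> pverts G" "v \<in> pverts G" "u \<noteq> v" using G_conditions edge by (auto simp: irrefl_def)
    moreover from this have "?\<phi> u \<noteq> ?\<phi> v" using inj_onD[OF g_injective(1)] by blast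
    moreover have "f u = f v \<or> (f u, f v) \<in> parcs H"
      using f_partition edge calculation(1,2) by (auto simp: H_partition_def)
    ultimately show ?thesis
      using f_partition g_injective(2)
      by (auto simp: H_partition_def strong_product_def complete_graph_def)
  qed
  then have "map_prod ?\<phi> ?\<phi> ` parcs G \<subseteq> parcs ?K" by auto
  moreover have "parcs ?K \<subseteq> pverts ?K \<times> pverts ?K" by (auto simp: strong_product_def)
  ultimately show ?thesis using subgraph_up_to_isoI[OF pair_graph_G _ g_injective(1) verts] by blast
qed

section \<open>Partitioning along clique models\<close>

definition attached_parts :: "'a rel \<Rightarrow> 'a set \<Rightarrow> ('a \<Rightarrow> 'b) \<Rightarrow> 'a set \<Rightarrow> 'b set" where
  "attached_parts E W f C = f ` (W \<inter> E `` C)"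

definition rooted_clique_model ::
  "'a rel \<Rightarrow> 'a set \<Rightarrow> 'a set \<Rightarrow> ('a \<Rightarrow> 'b) \<Rightarrow> 'a set \<Rightarrow> ('b \<Rightarrow> 'a set) \<Rightarrow> bool" where
  "rooted_clique_model E V W f C B \<longleftrightarrow> clique_model E (attached_parts E W f C) B \<and>
     (\<forall>i\<in>attached_parts E W f C. B i \<subseteq> V - C) \<and> (\<forall>u\<in>W \<inter> E `` C. u \<in> B (f u))"

definition admissible_component ::
  "'a rel \<Rightarrow> 'a set \<Rightarrow> nat \<Rightarrow> 'a set \<Rightarrow> ('a \<Rightarrow> nat) \<Rightarrow> (nat \<Rightarrow> nat set) \<Rightarrow> 'a set \<Rightarrow> bool" where
  "admissible_component E V s W f P C \<longleftrightarrow> card (attached_parts E W f C) \<le> s \<and>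
     ordered_clique P (attached_parts E W f C) \<and> (\<exists>B. rooted_clique_model E V W f C B)"

definition partial_partition ::
  "'a rel \<Rightarrow> 'a set \<Rightarrow> nat \<Rightarrow> nat \<Rightarrow> 'a set \<Rightarrow> nat \<Rightarrow> ('a \<Rightarrow> nat) \<Rightarrow> (nat \<Rightarrow> nat set) \<Rightarrow> bool" where
  "partial_partition E V s M W N f P \<longleftrightarrow>
     W \<subseteq> V \<and> elimination_order s N P \<and> H_partition E W (elimination_graph N P) M f \<and>
     (\<forall>C. is_component E (V - W) C \<longrightarrow> admissible_component E V s W f P C)"

lemma clique_model_mono: "clique_model E K B \<Longrightarrow> K' \<subseteq> K \<Longrightarrow> clique_model E K' B"
  unfolding clique_model_def using disjoint_family_on_mono by (metis subsetD)

lemma clique_model_insert: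
  assumes "sym E" "clique_model E K B" "k \<notin> K" "connected_in E S"
    and S_contacts: "\<And>i. i \<in> K \<Longrightarrow> S \<inter> B i = {} \<and> S \<inter> E `` B i \<noteq> {}"
  shows "clique_model E (insert k K) (B(k := S))"
proof -
  have "E `` S \<inter> B i \<noteq> {}" if "i \<in> K" for i
    using S_contacts[OF that] symD[OF assms(1)] by blast
  moreover have "disjoint_family_on (B(k := S)) (insert k K)"
    using assms(2,3) S_contacts by (auto simp: clique_model_def disjoint_family_on_def)
  ultimately show ?thesis
    using assms(2-4) S_contacts by (auto simp: clique_model_def Int_commute)
qed

lemma card_fibre_add_part:
  assumes "\<And>i. card {v \<in> W. f v = i} \<le> M" "k \<notin> f ` W" "X \<inter> W = {}" "card X \<le> M"
  shows "card {v \<in> W \<union> X. override_on f (\<lambda>_. k) X v = i} \<le> M"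
proof (cases "i = k")
  case True
  then have "{v \<in> W \<union> X. override_on f (\<lambda>_. k) X v = i} = X"
    using assms(2) by (auto simp: override_on_def split: if_splits)
  then show ?thesis using assms(4) by simp
next
  case False
  then have "{v \<in> W \<union> X. override_on f (\<lambda>_. k) X v = i} = {v \<in> W. f v = i}"
    using assms(3) by (auto simp: override_on_def split: if_splits)
  then show ?thesis using assms(1) by simp
qed

lemma H_partition_add_part:
  assumes "sym E" and partition: "H_partition E W (elimination_graph N P) M f"
    and "X \<inter> W = {}" "card X \<le> M" and "attached_parts E W f X \<subseteq> K"
  shows "H_partition E (W \<union> X) (elimination_graph (Suc N) (P(N := K))) M (override_on f (\<lambda>_. N) X)"
    (is "H_partition E _ ?H M ?f")
proof -
  have on_W: "?f v = f v" "f v < N" if "v \<in> W" for v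
    using partition assms(3) that
    by (auto simp: override_on_def H_partition_def elimination_graph_def)
  have on_X: "?f v = N" if "v \<in> X" for v using that by simp
  have "?f u = ?f v \<or> (?f u, ?f v) \<in> parcs ?H"
    if edge: "u \<in> W \<union> X" "v \<in> W \<union> X" "(u, v) \<in> E" for u v
  proof -
    have attached: "f w \<in> K" if "w \<in> W" "x \<in> X" "(x, w) \<in> E" for w x
      using assms(5) that by (auto simp: attached_parts_def)
    consider (old) "u \<in> W" "v \<in> W" | (old_new) "u \<in> W" "v \<in> X"
      | (new_old) "u \<in> X" "v \<in> W" | (new) "u \<in> X" "v \<in> X"
      using edge by auto
    then show ?thesis
    proof cases
      case old
      then have "f u = f v \<or> f u \<in> P (f v) \<or> f v \<in> P (f u)"
        using partition edge(3) by (auto simp: H_partition_def elimination_graph_def)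
      then show ?thesis using on_W[OF old(1)] on_W[OF old(2)] by (auto simp: elimination_graph_def)
    next
      case old_new
      then show ?thesis
        using attached[OF old_new symD[OF assms(1) edge(3)]] on_W[OF old_new(1)] on_X
        by (simp add: elimination_graph_def)
    next
      case new_old
      then show ?thesis
        using attached[OF new_old(2,1) edge(3)] on_W[OF new_old(2)] on_X
        by (simp add: elimination_graph_def)
    qed (use on_X in simp)
  qed
  moreover have "?f ` (W \<union> X) \<subseteq> pverts ?H"
    using on_W on_X by (fastforce simp: elimination_graph_def)
  moreover have "card {v \<in> W \<union> X. ?f v = i} \<le> M" for i
    using partition on_W(2) assms(3,4) by (intro card_fibre_add_part) (auto simp: H_partition_def)
  ultimately show ?thesis unfolding H_partition_def by blast
qed

lemma admissible_component_unaffected: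
  assumes "admissible_component E V s W f P D" "X \<inter> W = {}" "E `` D \<inter> X = {}" "f ` W \<subseteq> {..<N}"
  shows "admissible_component E V s (W \<union> X) (override_on f (\<lambda>_. N) X) (P(N := K)) D"
    (is "admissible_component E V s _ ?f _ D")
proof -
  have roots: "(W \<union> X) \<inter> E `` D = W \<inter> E `` D" using assms(3) by blast
  have on_W: "?f v = f v" if "v \<in> W" for v using that assms(2) by (auto simp: override_on_def)
  have parts: "attached_parts E (W \<union> X) ?f D = attached_parts E W f D"
    unfolding attached_parts_def roots using on_W by (intro image_cong) auto
  have "attached_parts E W f D \<subseteq> {..<N}" using assms(4) by (auto simp: attached_parts_def)
  moreover have "rooted_clique_model E V (W \<union> X) ?f D B" if "rooted_clique_model E V W f D B" for B
    using that on_W unfolding rooted_clique_model_def parts roots by auto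
  ultimately show ?thesis
    using assms(1) ordered_clique_upd unfolding admissible_component_def parts by blast
qed

lemma attached_parts_add_part:
  "attached_parts E (W \<union> X) (override_on f (\<lambda>_. k) X) D \<subseteq> insert k (attached_parts E W f D)"
  by (auto simp: attached_parts_def override_on_def)

lemma rooted_clique_model_add_part:
  assumes "sym E" and B_model: "rooted_clique_model E V W f C B"
    and "k \<notin> f ` W" "D \<subseteq> C" "X \<inter> W = {}"
    and K_parts: "attached_parts E W f D \<subseteq> K" "K \<subseteq> attached_parts E W f C"
    and S_branch: "X \<subseteq> S" "S \<subseteq> V - D" "connected_in E S"
      "\<And>i. i \<in> K \<Longrightarrow> S \<inter> B i = {} \<and> S \<inter> E `` B i \<noteq> {}"
  shows "rooted_clique_model E V (W \<union> X) (override_on f (\<lambda>_. k) X) D (B(k := S))"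
    (is "rooted_clique_model E V _ ?f D ?B")
proof -
  let ?L = "attached_parts E (W \<union> X) ?f D"
  have "k \<notin> K" using K_parts(2) assms(3) by (auto simp: attached_parts_def)
  have L_subset: "?L \<subseteq> insert k K" using attached_parts_add_part[of E W X f k D] K_parts(1) by blast
  have "clique_model E K B"
    using B_model K_parts(2) clique_model_mono by (auto simp: rooted_clique_model_def)
  then have "clique_model E (insert k K) ?B"
    by (rule clique_model_insert[OF assms(1) _ \<open>k \<notin> K\<close> S_branch(3) S_branch(4)])
  then have "clique_model E ?L ?B" using L_subset by (rule clique_model_mono)
  moreover have "?B i \<subseteq> V - D" if "i \<in> ?L" for i
  proof -
    have "B i \<subseteq> V - C" if "i \<in> K" for i
      using B_model K_parts(2) that by (auto simp: rooted_clique_model_def)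
    then show ?thesis using that L_subset S_branch(2) assms(4) by (cases "i = k") (simp, fastforce)
  qed
  moreover have "u \<in> ?B (?f u)" if u_mem: "u \<in> (W \<union> X) \<inter> E `` D" for u
  proof (cases "u \<in> X")
    case True
    then show ?thesis using S_branch(1) by auto
  next
    case False
    then have "u \<in> W" "u \<in> E `` C" using u_mem assms(4) by auto
    moreover from this have "f u \<noteq> k" using assms(3) by blast
    ultimately show ?thesis using B_model False by (simp add: rooted_clique_model_def)
  qed
  ultimately show ?thesis unfolding rooted_clique_model_def by blast
qed

lemma admissible_component_new:
  assumes "sym E" and B_model: "rooted_clique_model E V W f C B"
    and "ordered_clique P (attached_parts E W f C)"
    and part_index_less: "f ` W \<subseteq> {..<N}" and "D \<subseteq> C" "X \<inter> W = {}"
    and K_parts: "attached_parts E W f D \<subseteq> K" "K \<subseteq> attached_parts E W f C" "card K < s"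
    and S_branch: "X \<subseteq> S" "S \<subseteq> V - D" "connected_in E S"
      "\<And>i. i \<in> K \<Longrightarrow> S \<inter> B i = {} \<and> S \<inter> E `` B i \<noteq> {}"
  shows "admissible_component E V s (W \<union> X) (override_on f (\<lambda>_. N) X)
    (P(N := attached_parts E W f C)) D"
    (is "admissible_component E V s _ ?f ?P D")
proof -
  let ?L = "attached_parts E (W \<union> X) ?f D" and ?K = "attached_parts E W f C"
  have parts_less: "?K \<subseteq> {..<N}" using part_index_less by (auto simp: attached_parts_def)
  then have finite_K: "finite K" using K_parts(2) by (meson finite_lessThan finite_subset)
  have L_subset: "?L \<subseteq> insert N K" using attached_parts_add_part[of E W X f N D] K_parts(1) by blast
  then have "card ?L \<le> card (insert N K)" using finite_K by (intro card_mono) auto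
  also have "\<dots> \<le> s" using K_parts(3) finite_K by (simp add: card_insert_if)
  finally have "card ?L \<le> s" .
  moreover have "ordered_clique ?P ?L"
    using ordered_clique_insert_last[OF assms(3) parts_less]
    by (rule ordered_clique_mono) (use L_subset K_parts(2) in blast)
  moreover have "rooted_clique_model E V (W \<union> X) ?f D (B(N := S))"
    by (rule rooted_clique_model_add_part[OF assms(1) B_model _ assms(5,6) K_parts(1,2)
          S_branch(1,2,3) S_branch(4)])
      (use part_index_less in auto)
  ultimately show ?thesis unfolding admissible_component_def by blast
qed

text \<open>By minimality every \<open>z \<in> Z\<close> lies on a connector that meets \<open>Z\<close> only in \<open>z\<close>; its part from a
  neighbour of \<open>A\<close> to \<open>z\<close> cannot enter \<open>D\<close>, because \<open>D\<close> contains no neighbour of \<open>A\<close>.\<close>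

lemma minimal_separator_absorbed:
  assumes "sym E" "connected_in E A" "A \<inter> C = {}" "E `` A \<in> \<A>"
    and Z_minimal: "separates E C \<A> Z" "\<And>z. z \<in> Z \<Longrightarrow> \<not> separates E C \<A> (Z - {z})"
    and D_component: "is_component E (C - Z) D" "D \<inter> E `` A = {}"
  obtains S where "connected_in E S" "A \<union> Z \<subseteq> S" "S \<subseteq> A \<union> (C - D)"
proof -
  let ?S = "reach_within E (A \<union> (C - D)) A"
  have closed: "y \<in> ?S" if "x \<in> ?S" "(x, y) \<in> E" "y \<in> A \<union> (C - D)" for x y
    using closed_in_reach_within[of E "A \<union> (C - D)" A] that unfolding closed_in_def by blast
  have S_bounds: "A \<subseteq> ?S" "?S \<subseteq> A \<union> (C - D)"
    using reach_within_base[of A "A \<union> (C - D)" E] reach_within_subset[of E "A \<union> (C - D)" A] by auto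
  have "z \<in> ?S" if z_mem: "z \<in> Z" for z
  proof (rule ccontr)
    assume z_notin: "z \<notin> ?S"
    obtain Q where Q_connector: "connector E (C - (Z - {z})) \<A> Q"
      using Z_minimal(1) Z_minimal(2)[OF z_mem] unfolding separates_def by blast
    then have Q_subset: "Q \<subseteq> C - (Z - {z})" "connected_in E Q" by (auto simp: connector_def)
    have "\<not> connector E (C - Z) \<A> Q" using Z_minimal(1) by (simp add: separates_def)
    then have z_in_Q: "z \<in> Q" using Q_connector by (auto simp: connector_def)
    have "Q \<inter> E `` A \<noteq> {}" using Q_connector assms(4) by (simp add: connector_def)
    then obtain q where q_mem: "q \<in> Q" "q \<in> E `` A" by blast
    then have "q \<in> ?S" using closed Q_subset(1) S_bounds(1) D_component(2) by blast
    obtain x y where crossing: "x \<in> Q" "x \<in> ?S" "y \<in> Q" "y \<notin> ?S" "(x, y) \<in> E"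
      using connected_in_crossing[OF Q_subset(2) q_mem(1) \<open>q \<in> ?S\<close> z_in_Q z_notin] .
    have "y \<in> D" using closed[OF crossing(2,5)] crossing(3,4) Q_subset(1) by blast
    moreover have "x \<in> C - Z" using crossing(1,2) z_notin Q_subset(1) by blast
    ultimately have "x \<in> D"
      using is_component_step[OF D_component(1) _ _ symD[OF assms(1) crossing(5)]] by blast
    then show False
      using crossing(2) S_bounds(2) assms(3) is_component_subset[OF D_component(1)] by blast
  qed
  moreover have "connected_in E ?S" using assms(1,2) by (intro connected_in_reach_within) auto
  ultimately show ?thesis using that[of ?S] S_bounds by blast
qed

locale attached_component =
  fixes E :: "'a rel" and V :: "'a set" and s M :: nat
    and W :: "'a set" and N :: nat and f :: "'a \<Rightarrow> nat" and P :: "nat \<Rightarrow> nat set"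
    and C :: "'a set" and B :: "nat \<Rightarrow> 'a set"
  assumes sym_E: "sym E" and finite_V: "finite V"
    and partition: "partial_partition E V s M W N f P"
    and component: "is_component E (V - W) C"
    and model: "rooted_clique_model E V W f C B"
begin

abbreviation parts :: "nat set" where
  "parts \<equiv> attached_parts E W f C"

abbreviation contacts :: "'a set set" where
  "contacts \<equiv> (\<lambda>i. E `` B i) ` parts"

abbreviation extended_by :: "'a set \<Rightarrow> bool" where
  "extended_by X \<equiv> partial_partition E V s M (W \<union> X) (Suc N) (override_on f (\<lambda>_. N) X)
     (P(N := parts))"

lemma component_subset: "C \<subseteq> V - W"
  using component by (rule is_component_subset)

lemma component_connected: "connected_in E C"
  using component by (rule is_component_connected)

lemma finite_component: "finite C"
  using component_subset finite_V finite_subset by blast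

lemma W_subset: "W \<subseteq> V" and part_index_less: "f ` W \<subseteq> {..<N}"
  using partition by (auto simp: partial_partition_def H_partition_def elimination_graph_def)

lemma parts_subset: "parts \<subseteq> {..<N}"
  using part_index_less by (auto simp: attached_parts_def)

lemma finite_parts: "finite parts"
  using parts_subset finite_subset by blast

lemma parts_admissible: "card parts \<le> s" "ordered_clique P parts"
  using partition component by (auto simp: partial_partition_def admissible_component_def)

lemma branch_clique_model: "clique_model E parts B"
  using model by (simp add: rooted_clique_model_def)

lemma branch_subset: "i \<in> parts \<Longrightarrow> B i \<subseteq> V - C"
  using model by (simp add: rooted_clique_model_def)

lemma branch_connected: "i \<in> parts \<Longrightarrow> connected_in E (B i)"
  using branch_clique_model by (simp add: clique_model_def)

lemma attached_parts_contacts: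
  assumes "D \<subseteq> C" "i \<in> attached_parts E W f D"
  shows "i \<in> parts" "D \<inter> E `` B i \<noteq> {}"
proof -
  obtain u where u_mem: "u \<in> W" "u \<in> E `` D" "i = f u"
    using assms(2) by (auto simp: attached_parts_def)
  then show "i \<in> parts" using assms(1) by (auto simp: attached_parts_def)
  have "u \<in> W \<inter> E `` C" using u_mem assms(1) by blast
  then have "u \<in> B i" using model u_mem(3) by (simp add: rooted_clique_model_def)
  then show "D \<inter> E `` B i \<noteq> {}" using u_mem(2) symD[OF sym_E] by blast
qed

lemma component_connector: "connector E C contacts C"
  using component_connected attached_parts_contacts(2)[OF order_refl] by (auto simp: connector_def)

definition new_branch :: "'a set \<Rightarrow> 'a set \<Rightarrow> nat set \<Rightarrow> 'a set \<Rightarrow> bool" where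
  "new_branch X D K S \<longleftrightarrow> attached_parts E W f D \<subseteq> K \<and> K \<subseteq> parts \<and> card K < s \<and>
     X \<subseteq> S \<and> S \<subseteq> V - D \<and> connected_in E S \<and> (\<forall>i\<in>K. S \<inter> B i = {} \<and> S \<inter> E `` B i \<noteq> {})"

lemma add_part:
  assumes X_part: "X \<subseteq> C" "card X \<le> M"
    and new: "\<And>D. is_component E (C - X) D \<Longrightarrow> \<exists>K S. new_branch X D K S"
  shows "extended_by X"
  unfolding partial_partition_def
proof (intro conjI allI impI)
  have X_disjoint: "X \<inter> W = {}" using X_part(1) component_subset by blast
  show "W \<union> X \<subseteq> V" using W_subset X_part(1) component_subset by blast
  show "elimination_order s (Suc N) (P(N := parts))"
    using partition parts_subset parts_admissible
    by (intro elimination_order_Suc) (auto simp: partial_partition_def)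
  have "attached_parts E W f X \<subseteq> parts" using X_part(1) by (auto simp: attached_parts_def)
  then show "H_partition E (W \<union> X) (elimination_graph (Suc N) (P(N := parts)))
      M (override_on f (\<lambda>_. N) X)"
    using partition X_disjoint X_part(2)
    by (intro H_partition_add_part[OF sym_E]) (auto simp: partial_partition_def)
  fix D assume "is_component E (V - (W \<union> X)) D"
  then have "is_component E (V - W - X) D" by (simp add: Diff_Un Diff_Diff_Int set_diff_eq)
  then show "admissible_component E V s (W \<union> X) (override_on f (\<lambda>_. N) X) (P(N := parts)) D"
  proof (rule is_component_Diff_cases[OF sym_E component X_part(1)])
    assume D_component: "is_component E (C - X) D"
    then have "D \<subseteq> C" using is_component_subset by blast
    moreover obtain K S where "new_branch X D K S" using new[OF D_component] by blast
    ultimately show ?thesis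
      using admissible_component_new[OF sym_E model parts_admissible(2) part_index_less
          _ X_disjoint]
      unfolding new_branch_def by blast
  next
    assume "is_component E (V - W) D" "E `` D \<inter> X = {}"
    then show ?thesis
      using partition X_disjoint part_index_less
      by (intro admissible_component_unaffected) (auto simp: partial_partition_def)
  qed
qed

lemma add_connector:
  assumes X_connector: "connector E C contacts X" "card X \<le> M" and "card parts < s"
  shows "extended_by X"
proof -
  have X_subset: "X \<subseteq> C" "connected_in E X"
    using X_connector(1) by (auto simp: connector_def)
  show ?thesis
  proof (rule add_part[OF X_subset(1) X_connector(2)])
    fix D assume "is_component E (C - X) D"
    then have D_subset: "D \<subseteq> C - X" by (rule is_component_subset)
    have "attached_parts E W f D \<subseteq> parts" using D_subset attached_parts_contacts(1)[of D] by blast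
    moreover have "X \<subseteq> V - D" using X_subset(1) component_subset D_subset by blast
    moreover have "X \<inter> B i = {} \<and> X \<inter> E `` B i \<noteq> {}" if "i \<in> parts" for i
      using X_connector(1) branch_subset[OF that] that unfolding connector_def by blast
    ultimately have "new_branch X D parts X"
      using assms(3) X_subset(2) unfolding new_branch_def by blast
    then show "\<exists>K S. new_branch X D K S" by blast
  qed
qed

lemma add_separator:
  assumes "separates E C contacts Z" "card Z \<le> M"
  obtains Y where "Y \<noteq> {}" "Y \<subseteq> C" "extended_by Y"
proof -
  obtain Y where Y_minimal: "separates E C contacts Y" "card Y \<le> card Z"
    "\<And>y. y \<in> Y \<Longrightarrow> \<not> separates E C contacts (Y - {y})"
    using minimal_separator_exists[OF assms(1) finite_component] by blast
  have Y_subset: "Y \<subseteq> C" using Y_minimal(1) by (simp add: separates_def)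
  have "extended_by Y"
  proof (rule add_part[OF Y_subset])
    show "card Y \<le> M" using Y_minimal(2) assms(2) by simp
    fix D assume D_component: "is_component E (C - Y) D"
    have D_subset: "D \<subseteq> C - Y" and "\<not> connector E (C - Y) contacts D"
      using is_component_subset[OF D_component] Y_minimal(1) by (auto simp: separates_def)
    then obtain k where missed: "k \<in> parts" "D \<inter> E `` B k = {}"
      using is_component_connected[OF D_component] by (auto simp: connector_def)
    have "B k \<inter> C = {}" using branch_subset[OF missed(1)] by blast
    then obtain S where S_branch: "connected_in E S" "B k \<union> Y \<subseteq> S" "S \<subseteq> B k \<union> (C - D)"
      using minimal_separator_absorbed[OF sym_E branch_connected[OF missed(1)] _ _
          Y_minimal(1,3) D_component missed(2)] missed(1)
      by blast
    have "attached_parts E W f D \<subseteq> parts - {k}"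
      using attached_parts_contacts[of D] D_subset missed(2) by blast
    moreover have "card (parts - {k}) < s"
      using parts_admissible(1) card_Diff1_less[OF finite_parts missed(1)] by linarith
    moreover have "S \<subseteq> V - D"
      using S_branch(3) branch_subset[OF missed(1)] component_subset D_subset by blast
    moreover have "S \<inter> B i = {} \<and> S \<inter> E `` B i \<noteq> {}" if i_mem: "i \<in> parts - {k}" for i
    proof -
      have "B i \<inter> B k = {}" "E `` B i \<inter> B k \<noteq> {}"
        using branch_clique_model i_mem missed(1)
        by (auto simp: clique_model_def disjoint_family_on_def)
      then show ?thesis using S_branch(2,3) branch_subset[of i] i_mem by blast
    qed
    ultimately have "new_branch Y D (parts - {k}) S"
      using S_branch(1,2) unfolding new_branch_def by blast
    then show "\<exists>K S. new_branch Y D K S" by blast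
  qed
  moreover have "Y \<noteq> {}" using Y_minimal(1) component_connector by (auto simp: separates_def)
  ultimately show ?thesis using that Y_subset by blast
qed

lemma extend_if_hit_or_separate:
  assumes "hit_or_separate E V (s - 1) M" "card parts < s"
  obtains X where "X \<noteq> {}" "X \<subseteq> C" "extended_by X"
proof -
  have "card contacts \<le> s - 1"
    using card_image_le[OF finite_parts, of "\<lambda>i. E `` B i"] assms(2) by linarith
  moreover have "finite contacts" "C \<subseteq> V" using finite_parts component_subset by auto
  ultimately consider (hit) X where "connector E C contacts X" "card X \<le> M"
    | (separate) Z where "separates E C contacts Z" "card Z \<le> M"
    using assms(1) component_connector unfolding hit_or_separate_def by meson
  then show ?thesis
  proof cases
    case hit
    then have "X \<noteq> {}" "X \<subseteq> C" using connector_nonempty by (auto simp: connector_def)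
    then show ?thesis using add_connector[OF hit assms(2)] by (rule that)
  next
    case separate
    then show ?thesis using that by (rule add_separator)
  qed
qed

lemma extend_if_pack_or_separate:
  assumes "pack_or_separate E V s t M" "\<nexists>F. packing E C contacts t F" "parts \<noteq> {}"
  obtains X where "X \<noteq> {}" "X \<subseteq> C" "extended_by X"
proof -
  have "card contacts \<le> s"
    using card_image_le[OF finite_parts, of "\<lambda>i. E `` B i"] parts_admissible(1) by linarith
  moreover have "finite contacts" "contacts \<noteq> {}" "C \<subseteq> V"
    using finite_parts assms(3) component_subset by auto
  ultimately obtain Z where "separates E C contacts Z" "card Z \<le> M"
    using assms(1,2) component_connector unfolding pack_or_separate_def by meson
  then show ?thesis using that by (rule add_separator)
qed

end

lemma partial_partition_extend:
  assumes pair_graph_G: "pair_graph G" and "s \<ge> 1" "t \<ge> 1" and free: "J_minor_free s t G"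
    and "hit_or_separate (parcs G) (pverts G) (s - 1) M"
    and "pack_or_separate (parcs G) (pverts G) s t M"
    and partition: "partial_partition (parcs G) (pverts G) s M W N f P" and "W \<noteq> pverts G"
  shows "\<exists>W' N' f' P'. partial_partition (parcs G) (pverts G) s M W' N' f' P' \<and> W \<subset> W'"
proof -
  let ?E = "parcs G" and ?V = "pverts G"
  have finite_verts: "finite ?V" and sym_arcs: "sym ?E"
    using pair_graph_G by (auto simp: pair_graph_iff)
  obtain v where "v \<in> ?V - W" using partition assms(8) by (auto simp: partial_partition_def)
  then obtain C where C_component: "is_component ?E (?V - W) C"
    using component_exists[OF sym_arcs] by metis
  then obtain B where B_model: "rooted_clique_model ?E ?V W f C B"
    using partition by (auto simp: partial_partition_def admissible_component_def)
  interpret attached_component ?E ?V s M W N f P C B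
    using sym_arcs finite_verts partition C_component B_model by (rule attached_component.intro)
  obtain X where X_extension: "X \<noteq> {}" "X \<subseteq> C" "extended_by X"
  proof (cases "card parts < s")
    case True
    then show ?thesis using extend_if_hit_or_separate[OF assms(5)] that by blast
  next
    case False
    then have "card parts = s" using parts_admissible(1) by simp
    moreover have "C \<subseteq> ?V" using component_subset by blast
    ultimately have "\<nexists>F. packing ?E C contacts t F" "parts \<noteq> {}"
      using not_J_minor_free_if_packing[OF pair_graph_G assms(3) finite_parts
          branch_clique_model branch_subset _ component_connected] free assms(2) by auto
    then show ?thesis using extend_if_pack_or_separate[OF assms(6)] that by blast
  qed
  have "W \<subset> W \<union> X" using X_extension(1,2) component_subset by blast
  then show ?thesis using X_extension(3) by (intro exI conjI)
qed

lemma complete_partition_exists: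
  assumes pair_graph_G: "pair_graph G" and "s \<ge> 1" "t \<ge> 1" "J_minor_free s t G"
    and "hit_or_separate (parcs G) (pverts G) (s - 1) M"
    "pack_or_separate (parcs G) (pverts G) s t M"
  shows "\<exists>N f P. partial_partition (parcs G) (pverts G) s M (pverts G) N f P"
proof -
  let ?pp = "partial_partition (parcs G) (pverts G) s M"
  have finite_verts: "finite (pverts G)" using pair_graph_G by (simp add: pair_graph_iff)
  have "\<exists>N f P. ?pp (pverts G) N f P" if "?pp W N f P" for W N f P
    using that
  proof (induction "card (pverts G - W)" arbitrary: W N f P rule: less_induct)
    case less
    show ?case
    proof (cases "W = pverts G")
      case True
      then show ?thesis using less.prems by blast
    next
      case False
      obtain W' N' f' P' where larger: "?pp W' N' f' P'" "W \<subset> W'"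
        using partial_partition_extend[OF assms less.prems False] by blast
      have "W' \<subseteq> pverts G" using larger(1) by (simp add: partial_partition_def)
      then have "card (pverts G - W') < card (pverts G - W)"
        using larger(2) finite_verts by (intro psubset_card_mono) auto
      then show ?thesis using less.hyps larger(1) by blast
    qed
  qed
  moreover have "?pp {} 0 (\<lambda>_. 0) (\<lambda>_. {})"
    by (simp add: partial_partition_def elimination_order_def H_partition_def
        admissible_component_def attached_parts_def rooted_clique_model_def clique_model_def
        ordered_clique_def disjoint_family_on_def)
  ultimately show ?thesis by blast
qed

theorem product_structure:
  assumes graph: "pair_graph G" "pverts G \<noteq> {}" and "s \<ge> 1" "t \<ge> 1" "J_minor_free s t G"
    and "hit_or_separate (parcs G) (pverts G) (s - 1) M"
    "pack_or_separate (parcs G) (pverts G) s t M"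
  shows "\<exists>H :: nat pair_pre_digraph. pair_graph H \<and> treewidth H \<le> int s \<and>
           subgraph_up_to_iso G (H \<boxtimes> complete_graph M)"
proof -
  obtain N f P where "partial_partition (parcs G) (pverts G) s M (pverts G) N f P"
    using complete_partition_exists[OF graph(1) assms(3-7)] by blast
  then have P_order: "elimination_order s N P"
    and f_partition: "H_partition (parcs G) (pverts G) (elimination_graph N P) M f"
    by (auto simp: partial_partition_def)
  have "N \<ge> 1"
    using f_partition graph(2) by (cases N) (auto simp: H_partition_def elimination_graph_def)
  then show ?thesis
    using treewidth_elimination_graph[OF P_order] pair_graph_elimination_graph[OF P_order]
      subgraph_up_to_iso_strong_product[OF graph(1) f_partition] by blast
qed

section \<open>The three regimes of the bound\<close>

lemma hit_or_separate_1:
  assumes "M \<ge> 1"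
  shows "hit_or_separate E V 1 M"
proof -
  have "\<exists>X. connector E C \<A> X \<and> card X \<le> M"
    if few_sets: "finite \<A>" "card \<A> \<le> 1"
      and C_connector: "connector E C \<A> C" for C and \<A> :: "'a set set"
  proof -
    obtain c where "c \<in> C" using connector_nonempty[OF C_connector] by blast
    consider "\<A> = {}" | A where "\<A> = {A}"
      using few_sets by (metis One_nat_def card_0_eq card_1_singletonE le_Suc_eq le_zero_eq)
    then obtain v where "v \<in> C" "\<forall>A\<in>\<A>. v \<in> A"
      using \<open>c \<in> C\<close> C_connector by cases (auto simp: connector_def)
    then show ?thesis using assms by (intro exI[of _ "{v}"]) (simp add: connector_def)
  qed
  then show ?thesis unfolding hit_or_separate_def by blast
qed

lemma pack_or_separate_2:
  assumes "finite V" "finite E" "sym E" "t \<le> M + 1"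
  shows "pack_or_separate E V 2 t M"
  unfolding pack_or_separate_def
proof (intro allI impI, elim conjE)
  fix C and \<A> :: "'a set set"
  assume "C \<subseteq> V" "finite \<A>" "\<A> \<noteq> {}" "card \<A> \<le> 2"
  have "card \<A> = 1 \<or> card \<A> = 2"
    using \<open>finite \<A>\<close> \<open>\<A> \<noteq> {}\<close> \<open>card \<A> \<le> 2\<close> card_gt_0_iff[of \<A>] by linarith
  then obtain A B where pair_eq: "\<A> = {A, B}" by (metis card_1_singletonE card_2_iff insert_absorb2)
  have "(\<exists>F. packing E C {A, B} t F) \<or> (\<exists>Z. separates E C {A, B} Z \<and> card Z < t)"
    using menger[OF assms(2,3) finite_subset[OF \<open>C \<subseteq> V\<close> assms(1)]] .
  moreover have "card Z \<le> M" if "card Z < t" for Z :: "'a set" using that assms(4) by simp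
  ultimately show "(\<exists>F. packing E C \<A> t F) \<or> (\<exists>Z. separates E C \<A> Z \<and> card Z \<le> M)"
    unfolding pair_eq by blast
qed

lemma hit_or_separate_Suc:
  assumes "finite V" "sym E" "d \<ge> 1" "d * card V < Suc M * Suc M"
  shows "hit_or_separate E V (Suc d) M"
  unfolding hit_or_separate_def
proof (intro allI impI, elim conjE)
  fix C and \<A> :: "'a set set"
  assume C_subset: "C \<subseteq> V" and few_sets: "finite \<A>" "card \<A> \<le> Suc d"
  have "card Z \<le> M" if "card Z * Suc M \<le> d * card C" for Z :: "'a set"
  proof -
    have "card Z * Suc M \<le> d * card V"
      using that card_mono[OF assms(1) C_subset] by (meson mult_le_mono2 order_trans)
    then have "card Z * Suc M < Suc M * Suc M" using assms(4) by linarith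
    then show ?thesis by (metis less_Suc_eq_le mult_less_cancel2)
  qed
  then show "(\<exists>X. connector E C \<A> X \<and> card X \<le> M) \<or> (\<exists>Z. separates E C \<A> Z \<and> card Z \<le> M)"
    using connector_or_separator[OF assms(2) finite_subset[OF C_subset assms(1)]
        few_sets assms(3), of M]
    by blast
qed

lemma pack_or_separate_single: "pack_or_separate E V k 1 M"
proof -
  have "packing E C \<A> 1 {C}" if "connector E C \<A> C" for C and \<A> :: "'a set set"
    using that by (simp add: packing_def)
  then show ?thesis unfolding pack_or_separate_def by blast
qed

lemma pack_or_separate_Suc:
  assumes "finite V" "sym E" "d \<ge> 1"
    and bound: "\<And>z. z * Suc q \<le> d * card V \<Longrightarrow> (t - 1) * q + z \<le> M"
  shows "pack_or_separate E V (Suc d) t M"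
  unfolding pack_or_separate_def
proof (intro allI impI, elim conjE)
  fix C and \<A> :: "'a set set"
  assume C_subset: "C \<subseteq> V" and few_sets: "finite \<A>" "card \<A> \<le> Suc d"
  have "card Z \<le> M" if "card Z \<le> (t - 1) * q + z" "z * Suc q \<le> d * card C" for z and Z :: "'a set"
  proof -
    have "z * Suc q \<le> d * card V"
      using that(2) card_mono[OF assms(1) C_subset] by (meson mult_le_mono2 order_trans)
    then show ?thesis using bound that(1) by (meson order_trans)
  qed
  then show "(\<exists>F. packing E C \<A> t F) \<or> (\<exists>Z. separates E C \<A> Z \<and> card Z \<le> M)"
    using packing_or_separator[OF assms(2) finite_subset[OF C_subset assms(1)]
        few_sets assms(3), of t q]
    by blast
qed

lemma less_Suc_nat_floor_square:
  assumes "sqrt (real a) \<le> x"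
  shows "a < Suc (nat \<lfloor>x\<rfloor>) * Suc (nat \<lfloor>x\<rfloor>)"
proof -
  have "0 \<le> x" using real_sqrt_ge_zero[of "real a"] assms by linarith
  then have "sqrt (real a) < real (Suc (nat \<lfloor>x\<rfloor>))" using assms by linarith
  then have "(sqrt (real a))\<^sup>2 < (real (Suc (nat \<lfloor>x\<rfloor>)))\<^sup>2" by (intro power_strict_mono) auto
  then have "real a < real (Suc (nat \<lfloor>x\<rfloor>) * Suc (nat \<lfloor>x\<rfloor>))"
    by (simp only: power2_eq_square of_nat_mult real_sqrt_mult_self abs_of_nat)
  then show ?thesis by (simp only: of_nat_less_iff)
qed

text \<open>The choice \<open>q = \<lfloor>sqrt (a / b)\<rfloor>\<close> balances \<open>b * q\<close> against \<open>z \<le> a / (q + 1)\<close>.\<close>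

lemma ex_balanced_bound:
  fixes a b :: nat
  assumes "a \<ge> 1" "b \<ge> 1"
  shows "\<exists>q. \<forall>z. z * Suc q \<le> a \<longrightarrow> b * q + z \<le> nat \<lfloor>2 * sqrt (real a * real b)\<rfloor>"
proof -
  define w where "w = sqrt (real a * real b)"
  define r where "r = w / real b"
  define q where "q = nat \<lfloor>r\<rfloor>"
  have w_facts: "w > 0" "w * w = real a * real b" using assms by (auto simp: w_def)
  have r_facts: "r > 0" "real b * r = w" "r * w = real a"
    using w_facts assms by (auto simp: r_def field_simps)
  have q_floor: "real q \<le> r" "r < real q + 1" unfolding q_def using r_facts(1) by auto
  have "b * q + z \<le> nat \<lfloor>2 * w\<rfloor>" if z_bound: "z * Suc q \<le> a" for z
  proof -
    have "real z * r \<le> real z * (real q + 1)" using q_floor(2) by (intro mult_left_mono) auto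
    also have "\<dots> = real (z * Suc q)" by (simp add: algebra_simps)
    also have "\<dots> \<le> r * w" using z_bound r_facts(3) by (simp only: of_nat_le_iff)
    finally have "real z \<le> w" using r_facts(1) by (simp add: mult.commute)
    moreover have "real b * real q \<le> w"
      using mult_left_mono[OF q_floor(1), of "real b"] r_facts(2) by simp
    ultimately have "real (b * q + z) \<le> 2 * w" by simp
    then show ?thesis by (simp add: le_nat_floor)
  qed
  then show ?thesis unfolding w_def by blast
qed

definition part_width :: "nat \<Rightarrow> nat \<Rightarrow> nat \<Rightarrow> real" where
  "part_width s t n = (if s \<in> {1, 2} then max (real t - 1) 1
     else if t = 1 then sqrt ((real s - 2) * real n)
     else 2 * sqrt ((real s - 1) * (real t - 1) * real n))"

lemma sqrt_le_part_width:
  assumes "s \<ge> 3" "t \<ge> 1"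
  shows "sqrt (real ((s - 2) * n)) \<le> part_width s t n"
proof (cases "t = 1")
  case True
  then show ?thesis using assms(1) by (simp add: part_width_def of_nat_diff)
next
  case False
  have "(real s - 1) * 1 \<le> (real s - 1) * (real t - 1)"
    using False assms by (intro mult_left_mono) auto
  then have "(real s - 2) * real n \<le> (real s - 1) * (real t - 1) * real n"
    by (intro mult_right_mono) auto
  then have "sqrt (real ((s - 2) * n)) \<le> sqrt ((real s - 1) * (real t - 1) * real n)"
    using assms(1) by (intro real_sqrt_le_mono) (simp add: of_nat_diff)
  also have "\<dots> \<le> 2 * sqrt ((real s - 1) * (real t - 1) * real n)" using assms by simp
  finally show ?thesis using False assms(1) by (simp add: part_width_def)
qed

lemma floor_part_width_le_2:
  assumes "s \<in> {1, 2}" "t \<ge> 1"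
  shows "1 \<le> nat \<lfloor>part_width s t n\<rfloor>" "t \<le> nat \<lfloor>part_width s t n\<rfloor> + 1"
  using assms le_nat_floor[of 1 "part_width s t n"] le_nat_floor[of "t - 1" "part_width s t n"]
  by (auto simp: part_width_def of_nat_diff)

lemma hit_or_separate_part_width:
  assumes "finite V" "sym E" "s \<ge> 1" "t \<ge> 1"
  shows "hit_or_separate E V (s - 1) (nat \<lfloor>part_width s t (card V)\<rfloor>)"
proof (cases "s \<in> {1, 2}")
  case True
  then have "s - 1 \<le> 1" by auto
  with hit_or_separate_1[OF floor_part_width_le_2(1)[OF True assms(4)]] show ?thesis
    by (rule hit_or_separate_mono)
next
  case False
  then have "s \<ge> 3" using assms(3) by auto
  then have "hit_or_separate E V (Suc (s - 2)) (nat \<lfloor>part_width s t (card V)\<rfloor>)"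
    using less_Suc_nat_floor_square[OF sqrt_le_part_width] assms(4)
    by (intro hit_or_separate_Suc[OF assms(1,2)]) auto
  moreover have "Suc (s - 2) = s - 1" using \<open>s \<ge> 3\<close> by simp
  ultimately show ?thesis by simp
qed

lemma pack_or_separate_part_width:
  assumes "finite V" "finite E" "sym E" "s \<ge> 1" "t \<ge> 1" "card V \<ge> 1"
  shows "pack_or_separate E V s t (nat \<lfloor>part_width s t (card V)\<rfloor>)"
proof -
  consider (le_2) "s \<in> {1, 2}" | (one) "t = 1" | (ge_3) "s \<ge> 3" "t \<noteq> 1" using assms(4) by force
  then show ?thesis
  proof cases
    case le_2
    then have "s \<le> 2" by auto
    with pack_or_separate_2[OF assms(1-3) floor_part_width_le_2(2)[OF le_2 assms(5)]] show ?thesis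
      by (rule pack_or_separate_mono)
  next
    case one
    then show ?thesis using pack_or_separate_single by simp
  next
    case ge_3
    let ?a = "(s - 1) * card V" and ?b = "t - 1"
    have width: "part_width s t (card V) = 2 * sqrt (real ?a * real ?b)"
      using ge_3 assms(5) by (simp add: part_width_def of_nat_diff ac_simps)
    have "?a \<ge> 1" "?b \<ge> 1" using ge_3 assms(5,6) by auto
    then obtain q where "\<forall>z. z * Suc q \<le> ?a \<longrightarrow> ?b * q + z \<le> nat \<lfloor>part_width s t (card V)\<rfloor>"
      using ex_balanced_bound unfolding width by blast
    then have "pack_or_separate E V (Suc (s - 1)) t (nat \<lfloor>part_width s t (card V)\<rfloor>)"
      using ge_3(1) by (intro pack_or_separate_Suc[OF assms(1,3)]) auto
    then show ?thesis using ge_3(1) by simp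
  qed
qed

theorem theorem22:
  fixes s t n :: nat and m :: real and G :: "'a pair_pre_digraph"
  assumes "s \<ge> 1" and "t \<ge> 1" and "n \<ge> 1"
    and "m = (if s \<in> {1, 2} then max (real t - 1) 1
              else if t = 1 then sqrt ((real s - 2) * real n)
              else 2 * sqrt ((real s - 1) * (real t - 1) * real n))"
    and "pair_graph G" and "card (pverts G) = n"
    and "J_minor_free s t G"
  shows "\<exists>H :: nat pair_pre_digraph. pair_graph H \<and> treewidth H \<le> int s \<and>
           subgraph_up_to_iso G (H \<boxtimes> complete_graph (nat \<lfloor>m\<rfloor>))"
proof -
  have finite_V: "finite (pverts G)" and sym_E: "sym (parcs G)"
    and "parcs G \<subseteq> pverts G \<times> pverts G"
    using assms(5) by (auto simp: pair_graph_iff)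
  then have finite_E: "finite (parcs G)" by (auto intro: finite_subset)
  have width: "m = part_width s t (card (pverts G))"
    using assms(4,6) by (simp add: part_width_def)
  have "pverts G \<noteq> {}" using assms(3,6) by auto
  moreover have "hit_or_separate (parcs G) (pverts G) (s - 1) (nat \<lfloor>m\<rfloor>)"
    using hit_or_separate_part_width[OF finite_V sym_E assms(1,2)] by (simp only: width)
  moreover have "pack_or_separate (parcs G) (pverts G) s t (nat \<lfloor>m\<rfloor>)"
    using pack_or_separate_part_width[OF finite_V finite_E sym_E assms(1,2)] assms(3,6)
    by (simp add: width)
  ultimately show ?thesis using product_structure[OF assms(5) _ assms(1,2,7)] by blast
qed

end
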